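(* Let $n\ge 1$ and let $m > m_1 > \dots > m_n > 0$ be integers. The dimension of the space of analytic solutions to the Mellin system associated with $(m;m_1,\dots,m_n)$ at a generic point of $\mathbb{C}^n$ (i.e., the holonomic rank of the Mellin system) equals $m^n$. Moreover, there exists a basis $\{f_I\}_{I\in B}$ of the space of analytic solutions around the origin such that for every $I\in B$ $$f_I(x) = x^I\,\tilde f_I(x_1^m,\dots,x_n^m),$$ where $\tilde f_I$ is analytic at $0$ and $\tilde f_I(0)\neq 0$.
   Context: Put $m_j' = m-m_j$ and $\theta_j = x_j\,\partial/\partial x_j$. The Mellin system associated with $(m;m_1,\dots,m_n)$ (i.e., with the algebraic equation $y^m + x_1y^{m_1}+\dots+x_ny^{m_n}-1=0$) is the following system of $n$ linear partial differential equations for $y(x)=y(x_1,\dots,x_n)$: $$\prod_{k=0}^{m_j-1}(m_1\theta_1+\dots+m_n\theta_n+mk+1)\prod_{k=0}^{m_j'-1}(m_1'\theta_1+\dots+m_n'\theta_n+mk-1)\,y(x) = (-1)^{m_j}m^m\frac{\partial^m y(x)}{\partial x_j^m},\quad j=1,\dots,n.$$ The set $B$ is $B=\{(i_1,\dots,i_n)\in\mathbb{Z}^n : 0\le i_j\le m-1 \text{ for } j=1,\dots,n\}$, and $x^I = x_1^{i_1}\cdots x_n^{i_n}$ for $I=(i_1,\dots,i_n)$. *)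

theory Defs
  imports "HOL-Analysis.Analysis"
begin

(* Points of C^n are complex ^ 'n, where the finite linearly ordered type 'n plays the role of
   {1,...,n}; multi-indices are nat ^ 'n. *)

definition mpow :: "complex ^ 'n::finite \<Rightarrow> nat ^ 'n \<Rightarrow> complex" where
  "mpow x I = (\<Prod>j\<in>UNIV. (x $ j) ^ (I $ j))"

(* The sum is unconditional, hence absolutely convergent, and runs over all multi-indices. *)
definition mv_analytic_at :: "(complex ^ 'n::finite \<Rightarrow> complex) \<Rightarrow> complex ^ 'n \<Rightarrow> bool" where
  "mv_analytic_at f a \<longleftrightarrow>
     (\<exists>c :: nat ^ 'n \<Rightarrow> complex.
        \<forall>\<^sub>F x in nhds a. ((\<lambda>I. c I * mpow (x - a) I) has_sum f x) UNIV)"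

definition mv_polynomial :: "(complex ^ 'n::finite \<Rightarrow> complex) \<Rightarrow> bool" where
  "mv_polynomial P \<longleftrightarrow>
     (\<exists>(A :: (nat ^ 'n) set) c. finite A \<and> P = (\<lambda>x. \<Sum>I\<in>A. c I * mpow x I))"

definition partial_deriv ::
    "'n::finite \<Rightarrow> (complex ^ 'n \<Rightarrow> complex) \<Rightarrow> complex ^ 'n \<Rightarrow> complex" where
  "partial_deriv j f x = deriv (\<lambda>t. f (x + axis j t)) 0"

definition theta :: "'n::finite \<Rightarrow> (complex ^ 'n \<Rightarrow> complex) \<Rightarrow> complex ^ 'n \<Rightarrow> complex" where
  "theta j f x = x $ j * partial_deriv j f x"

(* The operator a_1 theta_1 + ... + a_n theta_n + c. *)
definition theta_form ::
    "('n::finite \<Rightarrow> nat) \<Rightarrow> complex \<Rightarrow> (complex ^ 'n \<Rightarrow> complex) \<Rightarrow> complex ^ 'n \<Rightarrow> complex" where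
  "theta_form a c f x = (\<Sum>j\<in>UNIV. of_nat (a j) * theta j f x) + c * f x"

(* The composition L 0 o ... o L (N - 1).  The operators it is applied to commute on analytic
   functions, so the order of the factors is immaterial. *)
definition op_prod :: "nat \<Rightarrow> (nat \<Rightarrow> 'f \<Rightarrow> 'f) \<Rightarrow> 'f \<Rightarrow> 'f" where
  "op_prod N L = foldr (\<circ>) (map L [0..<N]) id"

(* mm j stands for m_j; the subtractions m - mm j are harmless since mm j < m is assumed. *)
definition mellin_lhs ::
    "nat \<Rightarrow> ('n::finite \<Rightarrow> nat) \<Rightarrow> 'n \<Rightarrow> (complex ^ 'n \<Rightarrow> complex) \<Rightarrow> complex ^ 'n \<Rightarrow> complex" where
  "mellin_lhs m mm j y =
     op_prod (mm j) (\<lambda>k. theta_form mm (of_nat (m * k) + 1))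
       (op_prod (m - mm j) (\<lambda>k. theta_form (\<lambda>i. m - mm i) (of_nat (m * k) - 1)) y)"

definition mellin_solutions ::
    "nat \<Rightarrow> ('n::finite \<Rightarrow> nat) \<Rightarrow> complex ^ 'n \<Rightarrow> (complex ^ 'n \<Rightarrow> complex) set" where
  "mellin_solutions m mm a =
     {y. mv_analytic_at y a \<and>
         (\<forall>\<^sub>F x in nhds a. \<forall>j.
            mellin_lhs m mm j y x = (- 1) ^ mm j * of_nat m ^ m * (partial_deriv j ^^ m) y x)}"

(* Solutions at a point a are germs: the members of S represent germs at a, and two functions
   represent the same germ iff they agree near a.  The family f, indexed by the finite set A, is
   a basis of the complex vector space of germs at a represented by S. *)
definition germ_basis ::
    "complex ^ 'n::finite \<Rightarrow> (complex ^ 'n \<Rightarrow> complex) set \<Rightarrow> 'i set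
       \<Rightarrow> ('i \<Rightarrow> complex ^ 'n \<Rightarrow> complex) \<Rightarrow> bool" where
  "germ_basis a S A f \<longleftrightarrow>
     finite A \<and> (\<forall>i\<in>A. f i \<in> S) \<and>
     (\<forall>c. (\<forall>\<^sub>F x in nhds a. (\<Sum>i\<in>A. c i * f i x) = 0) \<longrightarrow> (\<forall>i\<in>A. c i = 0)) \<and>
     (\<forall>g\<in>S. \<exists>c. \<forall>\<^sub>F x in nhds a. g x = (\<Sum>i\<in>A. c i * f i x))"

definition has_germ_dim ::
    "complex ^ 'n::finite \<Rightarrow> (complex ^ 'n \<Rightarrow> complex) set \<Rightarrow> nat \<Rightarrow> bool" where
  "has_germ_dim a S d \<longleftrightarrow> (\<exists>f. germ_basis a S {..<d} f)"

(* "Generic" means: outside a proper algebraic subset of C^n.  Over the complex numbers, a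
   polynomial is nonzero iff its function is, and the product of two nonzero polynomials is
   nonzero, so at most one r satisfies this. *)
definition has_holonomic_rank :: "nat \<Rightarrow> ('n::finite \<Rightarrow> nat) \<Rightarrow> nat \<Rightarrow> bool" where
  "has_holonomic_rank m mm r \<longleftrightarrow>
     (\<exists>P :: complex ^ 'n \<Rightarrow> complex. mv_polynomial P \<and> (\<exists>x. P x \<noteq> 0) \<and>
        (\<forall>a. P a \<noteq> 0 \<longrightarrow> has_germ_dim a (mellin_solutions m mm a) r))"

definition index_box :: "nat \<Rightarrow> (nat ^ 'n) set" where
  "index_box m = {I. \<forall>j. I $ j \<le> m - 1}"

end

(* Normalise a germ at a point by its derivatives u_K. The Mellin equations then become linear
   relations between the u_K whose coefficients are polynomials in the base point. At the origin
   they are two-term recurrences, u_(J + m e_j) = const * u_J, which leave exactly the u_I with I in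
   the box B free. By Gaussian elimination, started from the diagonal matrix found at the origin,
   there is a polynomial "discriminant", nonzero at 0, off whose zero set every u_K with K outside B
   is a linear combination of the u_I with I in B; only finitely many levels |K| need to be
   eliminated, because the principal parts of the differentiated equations do not change and no
   multi-index of large size lies in B. The resulting recursion also forces |u_K| <= A C^|K| |K|!,
   so that formal solutions converge.

   Existence at a generic point a: the universal coefficients expressing u_K through the u_I are
   holomorphic along the line through 0 and a, off the zeros of the discriminant. Whether they
   satisfy the Mellin relations is an identity between such functions. It holds near 0, because the
   m^n independent solutions found at the origin have an invertible fundamental matrix there, and
   hence it holds at a by the identity theorem. No integrability theorem is needed. *)
theory Submission
  imports Defs "HOL-Complex_Analysis.Conformal_Mappings"
begin

section \<open>Convergent power series in several variables\<close>

text \<open>The Mellin system is overdetermined: a derivative whose index leaves the box in several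
  directions is prescribed by several equations. The elimination commits to one equation per
  derivative outside the box, so that each size |K| yields a square linear system. Whether the
  remaining equations agree is the compatibility question, and exactly this is transported from the
  origin to a generic point. Away from the origin the top-order terms couple all derivatives of
  equal size; hence systems instead of recurrences, with box derivatives of the same size on the
  right-hand side. The systems stop at size n m because the entries of a box index are below m.
  Convergence rests on a balance: the coefficient of a term of order l < m in an equation
  differentiated J times grows at most like (|J|+1)^(m-l), and this is absorbed by the quotient of
  (|J|+m)! by (|J|+l)!. Complex lines through 0 keep the continuation in one variable: the zeros of
  the discriminant on such a line are countable, so the regular part of the line is
  connected.\<close>

definition msize :: "nat ^ 'n::finite \<Rightarrow> nat" where
  "msize I = (\<Sum>j\<in>UNIV. I $ j)"

definition vfact :: "nat ^ 'n::finite \<Rightarrow> nat" where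
  "vfact I = (\<Prod>j\<in>UNIV. fact (I $ j))"

lemma msize_add: "msize (I + J) = msize I + msize J"
  by (simp add: msize_def sum.distrib)

lemma msize_zero [simp]: "msize 0 = 0"
  by (simp add: msize_def)

lemma msize_axis [simp]: "msize (axis j k) = k"
  by (simp add: msize_def axis_def if_distrib sum.delta cong: if_cong)

lemma msize_nth_le: "I $ j \<le> msize I"
  unfolding msize_def by (rule member_le_sum) auto

lemma msize_eq_0_iff: "msize I = 0 \<longleftrightarrow> I = 0"
  by (simp add: msize_def vec_eq_iff)

lemma vfact_pos [simp]: "vfact I > 0"
  by (simp add: vfact_def prod_pos)

lemma vfact_nonzero [simp]: "vfact I \<noteq> 0"
  using vfact_pos[of I] by linarith

lemma vfact_zero [simp]: "vfact 0 = 1"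
  by (simp add: vfact_def)

lemma vfact_add_axis: "vfact (I + axis j 1) = (I $ j + 1) * vfact I"
proof -
  have "vfact (I + axis j 1) = fact (I $ j + 1) * (\<Prod>i\<in>UNIV - {j}. fact (I $ i))"
    unfolding vfact_def by (subst prod.remove[of _ j]) (auto simp: axis_def intro!: prod.cong)
  also have "\<dots> = (I $ j + 1) * (fact (I $ j) * (\<Prod>i\<in>UNIV - {j}. fact (I $ i)))"
    by (simp add: algebra_simps)
  also have "fact (I $ j) * (\<Prod>i\<in>UNIV - {j}. fact (I $ i)) = vfact I"
    unfolding vfact_def by (subst prod.remove[of UNIV j]) auto
  finally show ?thesis .
qed

text \<open>Each binomial coefficient is at most a power of two. The loss is geometric in the sizes,
  which is what makes \<open>convergent_coeffs\<close> stable under differentiation.\<close>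

lemma vfact_add_le: "vfact (I + K) \<le> 2 ^ (msize I + msize K) * (vfact I * vfact K)"
proof -
  have *: "fact (a + b) \<le> 2 ^ (a + b) * (fact a * fact b :: nat)" for a b :: nat
  proof -
    have "fact (a + b) = fact a * fact b * ((a + b) choose a)"
      using binomial_fact_lemma[of a "a + b"] by simp
    also have "\<dots> \<le> fact a * fact b * 2 ^ (a + b)"
      by (intro mult_left_mono binomial_le_pow2) auto
    finally show ?thesis by (simp add: mult_ac)
  qed
  have "vfact (I + K) \<le> (\<Prod>j\<in>UNIV. 2 ^ (I $ j + K $ j) * (fact (I $ j) * fact (K $ j)))"
    unfolding vfact_def by (intro prod_mono) (auto simp: *)
  also have "\<dots> = 2 ^ (msize I + msize K) * (vfact I * vfact K)"
    by (simp add: prod.distrib vfact_def power_sum msize_def sum.distrib power_add)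
  finally show ?thesis .
qed

lemma mpow_add: "mpow x (I + J) = mpow x I * mpow x J"
  by (simp add: mpow_def power_add prod.distrib)

lemma mpow_axis [simp]: "mpow x (axis j k) = x $ j ^ k"
  by (simp add: mpow_def axis_def if_distrib prod.delta cong: if_cong)

lemma mpow_zero_right [simp]: "mpow x 0 = 1"
  by (simp add: mpow_def)

lemma mpow_zero_left: "mpow 0 I = (if I = 0 then 1 else 0)"
proof (cases "I = 0")
  case False
  then obtain j where "I $ j \<noteq> 0"
    by (auto simp: vec_eq_iff)
  then have "mpow 0 I = 0"
    unfolding mpow_def by (intro prod_zero) (auto intro!: bexI[of _ j])
  with False show ?thesis by simp
qed simp

lemma norm_mpow_le:
  assumes "\<And>j. norm (x $ j) \<le> r"
  shows "norm (mpow x I) \<le> r ^ msize I"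
proof -
  have "norm (mpow x I) = (\<Prod>j\<in>UNIV. norm (x $ j) ^ (I $ j))"
    by (simp add: mpow_def prod_norm[symmetric] norm_power)
  also have "\<dots> \<le> (\<Prod>j\<in>UNIV. r ^ (I $ j))"
    by (intro prod_mono conjI power_mono) (auto simp: assms)
  also have "\<dots> = r ^ msize I"
    by (simp add: msize_def power_sum)
  finally show ?thesis .
qed

lemma finite_bounded_index [simp, intro]: "finite {I :: nat ^ 'n::finite. \<forall>j. I $ j \<le> N}"
proof -
  have "{I :: nat ^ 'n. \<forall>j. I $ j \<le> N} \<subseteq> vec_lambda ` (UNIV \<rightarrow>\<^sub>E {..N})"
  proof
    fix I :: "nat ^ 'n" assume "I \<in> {I. \<forall>j. I $ j \<le> N}"
    then have "vec_nth I \<in> UNIV \<rightarrow>\<^sub>E {..N}"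
      by auto
    then show "I \<in> vec_lambda ` (UNIV \<rightarrow>\<^sub>E {..N})"
      by (metis image_eqI vec_nth_inverse)
  qed
  then show ?thesis
    by (rule finite_subset) (auto intro!: finite_imageI finite_PiE)
qed

lemma finite_msize_le [simp, intro]: "finite {I :: nat ^ 'n::finite. msize I \<le> N}"
  by (rule finite_subset[OF _ finite_bounded_index[of N]])
     (use msize_nth_le order_trans in blast)

text \<open>A finite set of multi-indices lies in a cube, and over a cube the sum factorises into
  one-variable geometric sums.\<close>

lemma geometric_summable:
  fixes q :: real
  assumes "0 \<le> q" "q < 1"
  shows "(\<lambda>I :: nat ^ 'n::finite. q ^ msize I) summable_on UNIV"
proof (rule nonneg_bdd_above_summable_on)
  let ?M = "(1 / (1 - q)) ^ CARD('n)"
  have "(\<Sum>I\<in>F. q ^ msize I) \<le> ?M" if "finite F" for F :: "(nat ^ 'n) set"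
  proof -
    define N where "N = (\<Sum>I\<in>F. msize I)"
    have sub: "F \<subseteq> {I. \<forall>j. I $ j \<le> N}"
    proof safe
      fix I j assume "I \<in> F"
      then have "msize I \<le> N"
        unfolding N_def using that by (intro member_le_sum) auto
      then show "I $ j \<le> N"
        using msize_nth_le[of I j] by linarith
    qed
    have "(\<Sum>I\<in>F. q ^ msize I) \<le> (\<Sum>I\<in>{I :: nat ^ 'n. \<forall>j. I $ j \<le> N}. q ^ msize I)"
      by (intro sum_mono2 finite_bounded_index) (use sub assms in auto)
    also have "\<dots> = (\<Sum>g\<in>UNIV \<rightarrow>\<^sub>E {..N}. \<Prod>j\<in>(UNIV :: 'n set). q ^ g j)"
      by (rule sum.reindex_bij_witness[where i = vec_lambda and j = vec_nth])
         (auto simp: msize_def power_sum PiE_def Pi_def)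
    also have "\<dots> = (\<Prod>j\<in>(UNIV :: 'n set). \<Sum>k\<le>N. q ^ k)"
      by (subst prod_sum_PiE) auto
    also have "\<dots> \<le> (\<Prod>j\<in>(UNIV :: 'n set). 1 / (1 - q))"
    proof (intro prod_mono conjI)
      have "(\<Sum>k\<le>N. q ^ k) = (1 - q ^ Suc N) / (1 - q)"
        using assms by (subst sum_gp0) auto
      also have "\<dots> \<le> 1 / (1 - q)"
        using assms by (intro divide_right_mono) auto
      finally show "(\<Sum>k\<le>N. q ^ k) \<le> 1 / (1 - q)" .
    qed (use assms in \<open>auto intro!: sum_nonneg\<close>)
    also have "\<dots> = ?M"
      by simp
    finally show ?thesis .
  qed
  then show "bdd_above (sum (\<lambda>I :: nat ^ 'n. q ^ msize I) ` {F. F \<subseteq> UNIV \<and> finite F})"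
    by (intro bdd_aboveI[where M = ?M]) auto
qed (use assms in auto)

section \<open>Power series and their termwise calculus\<close>

text \<open>Coefficients are normalised as derivatives, so that differentiation becomes an index shift.\<close>
definition series_eval :: "(nat ^ 'n::finite \<Rightarrow> complex) \<Rightarrow> complex ^ 'n \<Rightarrow> complex" where
  "series_eval u h = (\<Sum>\<^sub>\<infinity>I. u I / of_nat (vfact I) * mpow h I)"

text \<open>Cauchy estimates for derivatives. Demanding \<open>B \<ge> 1\<close> makes the powers of
  \<open>B\<close> monotone, so that bounds can be enlarged freely.\<close>

definition convergent_coeffs :: "(nat ^ 'n::finite \<Rightarrow> complex) \<Rightarrow> bool" where
  "convergent_coeffs u \<longleftrightarrow> (\<exists>A\<ge>(0::real). \<exists>B\<ge>(1::real). \<forall>I. norm (u I) \<le> A * B ^ msize I * vfact I)"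

lemma eventually_small:
  assumes "r > 0"
  shows "\<forall>\<^sub>F h :: complex ^ 'n::finite in nhds 0. \<forall>j. norm (h $ j) < r"
proof -
  have "\<forall>\<^sub>F h :: complex ^ 'n in nhds 0. norm h < r"
    using assms by (auto simp: eventually_nhds_metric dist_norm)
  then show ?thesis
    by eventually_elim (meson Finite_Cartesian_Product.norm_nth_le le_less_trans)
qed

text \<open>The radius \<open>1 / (2 * B)\<close> leaves the ratio 1/2. The resulting majorant does
  not depend on \<open>h\<close> and serves both for summability and for uniform
  convergence.\<close>

lemma series_eval_term_bound:
  fixes A B :: real
  assumes "norm (u I) \<le> A * B ^ msize I * vfact I" "A \<ge> 0" "B \<ge> 1" "\<And>j. norm (h $ j) \<le> 1 / (2 * B)"
  shows "norm (u I / of_nat (vfact I) * mpow h I) \<le> A * (1/2) ^ msize I"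
proof -
  have "norm (u I / of_nat (vfact I) * mpow h I) = norm (u I) / vfact I * norm (mpow h I)"
    by (simp add: norm_mult norm_divide)
  also have "\<dots> \<le> (A * B ^ msize I) * (1 / (2 * B)) ^ msize I"
    using assms by (intro mult_mono norm_mpow_le) (auto simp: field_simps)
  also have "\<dots> = A * (B * (1 / (2 * B))) ^ msize I"
    by (simp only: power_mult_distrib mult_ac)
  also have "B * (1 / (2 * B)) = 1/2"
    using assms by simp
  finally show ?thesis .
qed

lemma half_summable: "(\<lambda>I :: nat ^ 'n::finite. A * (1/2 :: real) ^ msize I) summable_on UNIV"
  by (intro summable_on_cmult_right geometric_summable) auto

lemma series_eval_has_sum_explicit:
  fixes A B :: real and u :: "nat ^ 'n::finite \<Rightarrow> complex"
  assumes "\<And>I. norm (u I) \<le> A * B ^ msize I * vfact I" "A \<ge> 0" "B \<ge> 1" "\<And>j. norm (h $ j) \<le>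
    1 / (2 * B)"
  shows "((\<lambda>I. u I / of_nat (vfact I) * mpow h I) has_sum series_eval u h) UNIV"
proof -
  have "(\<lambda>I. u I / of_nat (vfact I) * mpow h I) summable_on UNIV"
    by (rule abs_summable_summable, rule summable_on_comparison_test[OF half_summable[of A]])
       (rule series_eval_term_bound[OF assms], rule norm_ge_zero)
  then show ?thesis
    by (simp add: series_eval_def)
qed

lemma convergent_coeffs_has_sum:
  fixes u :: "nat ^ 'n::finite \<Rightarrow> complex"
  assumes "convergent_coeffs u"
  shows "\<forall>\<^sub>F h in nhds 0. ((\<lambda>I. u I / of_nat (vfact I) * mpow h I) has_sum series_eval u h) UNIV"
proof -
  obtain A B :: real where AB: "A \<ge> 0" "B \<ge> 1" "\<And>I. norm (u I) \<le> A * B ^ msize I * vfact I"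
    using assms unfolding convergent_coeffs_def by auto
  have "\<forall>\<^sub>F h :: complex ^ 'n in nhds 0. \<forall>j. norm (h $ j) < 1 / (2 * B)"
    using AB by (intro eventually_small) auto
  then show ?thesis
    by eventually_elim (rule series_eval_has_sum_explicit[OF AB(3,1,2)], simp add: less_imp_le)
qed

lemma series_eval_zero: "series_eval u 0 = u 0"
proof -
  have "series_eval u 0 = (\<Sum>\<^sub>\<infinity>I\<in>{0}. u I / of_nat (vfact I) * mpow 0 I)"
    unfolding series_eval_def by (rule infsum_cong_neutral) (auto simp: mpow_zero_left)
  then show ?thesis by simp
qed

lemma convergent_coeffs_add:
  assumes "convergent_coeffs u" "convergent_coeffs v"
  shows "convergent_coeffs (\<lambda>I. u I + v I)"
proof -
  obtain A B :: real where u: "A \<ge> 0" "B \<ge> 1" "\<And>I. norm (u I) \<le> A * B ^ msize I * vfact I"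
    using assms unfolding convergent_coeffs_def by auto
  obtain A' B' :: real where v: "A' \<ge> 0" "B' \<ge> 1" "\<And>I. norm (v I) \<le> A' * B' ^ msize I * vfact I"
    using assms unfolding convergent_coeffs_def by auto
  have "norm (u I + v I) \<le> (A + A') * max B B' ^ msize I * vfact I" for I
  proof -
    have "norm (u I + v I) \<le> A * B ^ msize I * vfact I + A' * B' ^ msize I * vfact I"
      using norm_triangle_ineq[of "u I" "v I"] u(3)[of I] v(3)[of I] by linarith
    also have "\<dots> \<le> A * max B B' ^ msize I * vfact I + A' * max B B' ^ msize I * vfact I"
      using u v by (intro add_mono mult_right_mono mult_left_mono power_mono) auto
    finally show ?thesis by (simp add: algebra_simps)
  qed
  then show ?thesis
    unfolding convergent_coeffs_def using u v by (intro exI[of _ "A +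
      A'"] conjI exI[of _ "max B B'"]) auto
qed

lemma convergent_coeffs_scale:
  assumes "convergent_coeffs u"
  shows "convergent_coeffs (\<lambda>I. c * u I)"
proof -
  obtain A B :: real where u: "A \<ge> 0" "B \<ge> 1" "\<And>I. norm (u I) \<le> A * B ^ msize I * vfact I"
    using assms unfolding convergent_coeffs_def by auto
  have "norm (c * u I) \<le> (norm c * A) * B ^ msize I * vfact I" for I
    using mult_left_mono[OF u(3)[of I], of "norm c"] by (simp add: norm_mult mult_ac)
  then show ?thesis
    unfolding convergent_coeffs_def using u by (intro exI[of _ "norm c * A"] conjI exI[of _ B]) auto
qed

lemma convergent_coeffs_0 [simp]: "convergent_coeffs (\<lambda>I. 0)"
  unfolding convergent_coeffs_def by (intro exI[of _ 0] conjI exI[of _ 1]) auto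

lemma convergent_coeffs_sum:
  assumes "\<And>k. k \<in> S \<Longrightarrow> convergent_coeffs (u k)"
  shows "convergent_coeffs (\<lambda>I. \<Sum>k\<in>S. u k I)"
  using assms by (induction S rule: infinite_finite_induct) (auto intro: convergent_coeffs_add)

lemma convergent_coeffs_index_mult:
  assumes "convergent_coeffs u"
  shows "convergent_coeffs (\<lambda>I. of_nat (I $ j) * u I)"
proof -
  obtain A B :: real where u: "A \<ge> 0" "B \<ge> 1" "\<And>I. norm (u I) \<le> A * B ^ msize I * vfact I"
    using assms unfolding convergent_coeffs_def by auto
  have "norm (of_nat (I $ j) * u I) \<le> A * (2 * B) ^ msize I * vfact I" for I
  proof -
    have "I $ j \<le> 2 ^ msize I"
      by (meson less_exp less_imp_le msize_nth_le order_trans)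
    then have "real (I $ j) \<le> 2 ^ msize I"
      by (metis of_nat_le_iff of_nat_numeral of_nat_power)
    then have "norm (of_nat (I $ j) * u I) \<le> 2 ^ msize I * (A * B ^ msize I * vfact I)"
      unfolding norm_mult norm_of_nat using u by (intro mult_mono) auto
    then show ?thesis by (simp add: power_mult_distrib mult_ac)
  qed
  then show ?thesis
    unfolding convergent_coeffs_def using u by (intro exI[of _ A] conjI exI[of _ "2 * B"]) auto
qed

lemma convergent_coeffs_shift:
  assumes "convergent_coeffs u"
  shows "convergent_coeffs (\<lambda>I. u (I + K))"
proof -
  obtain A B :: real where u: "A \<ge> 0" "B \<ge> 1" "\<And>I. norm (u I) \<le> A * B ^ msize I * vfact I"
    using assms unfolding convergent_coeffs_def by auto
  define A' where "A' = A * (2 * B) ^ msize K * vfact K"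
  have "norm (u (I + K)) \<le> A' * (2 * B) ^ msize I * vfact I" for I
  proof -
    have "norm (u (I + K)) \<le> A * B ^ (msize I + msize K) * vfact (I + K)"
      using u(3)[of "I + K"] by (simp add: msize_add)
    also have "\<dots> \<le> A * B ^ (msize I + msize K) * (2 ^ (msize I + msize K) * (vfact I * vfact K))"
      using u of_nat_mono[OF vfact_add_le[of I K], where ?'a = real]
      by (intro mult_left_mono) auto
    also have "\<dots> = A' * (2 * B) ^ msize I * vfact I"
      by (simp add: A'_def power_add power_mult_distrib)
    finally show ?thesis .
  qed
  moreover have "A' \<ge> 0" "2 * B \<ge> 1"
    using u by (auto simp: A'_def)
  ultimately show ?thesis
    unfolding convergent_coeffs_def by blast
qed

text \<open>The second series is the termwise derivative in the \<open>j\<close>-th variable; the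
  factor \<open>I $ j\<close> cancels against the factorial. The truncated exponent
  \<open>I $ j - 1\<close> does no harm, since its term carries the factor 0 when
  \<open>I $ j = 0\<close>.\<close>

lemma has_sum_ev_shift:
  fixes u :: "nat ^ 'n::finite \<Rightarrow> complex"
  shows "((\<lambda>I. u (I + axis j 1) / of_nat (vfact I) * mpow h I) has_sum s) UNIV \<longleftrightarrow>
    ((\<lambda>I. of_nat (I $ j) * u I / of_nat (vfact I) *
      (h $ j ^ (I $ j - 1) * (\<Prod>i\<in>UNIV - {j}. h $ i ^ (I $ i)))) has_sum s) UNIV"
proof -
  have "((\<lambda>I. u (I + axis j 1) / of_nat (vfact I) * mpow h I) has_sum s) UNIV \<longleftrightarrow>
    ((\<lambda>I. of_nat (I $ j) * u I / of_nat (vfact I) *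
      (h $ j ^ (I $ j - 1) * (\<Prod>i\<in>UNIV - {j}. h $ i ^ (I $ i)))) has_sum s) {I. I $ j > 0}"
  proof (rule has_sum_reindex_bij_witness[where i = "\<lambda>I. I - axis j 1" and j = "\<lambda>I. I + axis j 1"])
    fix I :: "nat ^ 'n"
    have 1: "of_nat (vfact (I + axis j 1)) = of_nat (I $ j + 1) * (of_nat (vfact I) :: complex)"
      by (simp only: vfact_add_axis of_nat_mult)
    have "mpow h I = h $ j ^ (I $ j) * (\<Prod>i\<in>UNIV - {j}. h $ i ^ (I $ i))"
      unfolding mpow_def by (subst prod.remove[of UNIV j]) auto
    moreover have "(\<Prod>i\<in>UNIV - {j}. h $ i ^ ((I + axis j 1) $ i)) = (\<Prod>i\<in>UNIV - {j}. h $ i ^ (I $ i))"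
      by (intro prod.cong) (auto simp: axis_def)
    moreover have "(I + axis j 1) $ j = I $ j + 1"
      by (simp add: axis_def)
    moreover have "of_nat (I $ j + 1) * u (I + axis j 1) / of_nat (vfact (I + axis j 1)) =
        u (I + axis j 1) / of_nat (vfact I)"
      unfolding 1 by (simp del: of_nat_add of_nat_Suc)
    ultimately show "of_nat ((I + axis j 1) $ j) * u (I + axis j 1) / of_nat (vfact (I +
      axis j 1)) *
         (h $ j ^ ((I + axis j 1) $ j - 1) * (\<Prod>i\<in>UNIV - {j}. h $ i ^ ((I + axis j 1) $ i)))
      = u (I + axis j 1) / of_nat (vfact I) * mpow h I"
      by simp
  qed (auto simp: axis_def vec_eq_iff)
  also have "\<dots> \<longleftrightarrow> ((\<lambda>I. of_nat (I $ j) * u I / of_nat (vfact I) *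
      (h $ j ^ (I $ j - 1) * (\<Prod>i\<in>UNIV - {j}. h $ i ^ (I $ i)))) has_sum s) UNIV"
    by (rule has_sum_cong_neutral) auto
  finally show ?thesis .
qed

text \<open>For fixed \<open>h\<close> this is a statement about one complex variable
  \<open>t\<close>: partial sums converge uniformly on a disc, so their derivatives converge to the
  derivative of the limit. Uniqueness of sums identifies that limit with the shifted series.\<close>

lemma series_eval_deriv:
  fixes u :: "nat ^ 'n::finite \<Rightarrow> complex"
  assumes "convergent_coeffs u"
  shows "\<forall>\<^sub>F h in nhds 0. ((\<lambda>t. series_eval u (h +
    axis j t)) has_field_derivative series_eval (\<lambda>I. u (I + axis j 1)) h) (at 0)"
proof -
  obtain A B :: real where AB: "A \<ge> 0" "B \<ge> 1" "\<And>I. norm (u I) \<le> A * B ^ msize I * vfact I"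
    using assms unfolding convergent_coeffs_def by auto
  define r where "r = 1 / (2 * B)"
  have "r > 0" using AB by (simp add: r_def)
  have "\<forall>\<^sub>F h :: complex ^ 'n in nhds 0. \<forall>j. norm (h $ j) < r"
    using \<open>r > 0\<close> by (intro eventually_small) auto
  moreover have "\<forall>\<^sub>F h in nhds 0. ((\<lambda>I. u (I +
    axis j 1) / of_nat (vfact I) * mpow h I) has_sum series_eval (\<lambda>I. u (I + axis j 1)) h) UNIV"
    by (rule convergent_coeffs_has_sum) (rule convergent_coeffs_shift[OF assms])
  ultimately show ?thesis
  proof eventually_elim
    case (elim h)
    \<comment> \<open>Half of the room left in the \<open>j\<close>-th coordinate, so that the
      closed disc of radius \<open>\<rho>\<close> keeps \<open>h + axis j t\<close> inside the
      polydisc of the term bound.\<close>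
    define \<rho> where "\<rho> = (r - norm (h $ j)) / 2"
    have "\<rho> > 0" using elim by (simp add: \<rho>_def)
    define rest where "rest I = (\<Prod>i\<in>UNIV - {j}. h $ i ^ (I $ i))" for I :: "nat ^ 'n"
    have mp: "mpow (h + axis j t) I = (h $ j + t) ^ (I $ j) * rest I" for t I
      unfolding mpow_def rest_def
      by (subst prod.remove[of UNIV j]) (auto simp: axis_def intro!: prod.cong)
    have small: "norm ((h + axis j t) $ i) \<le> 1 / (2 * B)" if "t \<in> cball 0 \<rho>" for t i
    proof (cases "i = j")
      case True
      have "norm (h $ j + t) \<le> norm (h $ j) + \<rho>"
        using norm_triangle_ineq[of "h $ j" t] that by simp
      also have "\<dots> \<le> r"
        using elim(1) by (simp add: \<rho>_def field_simps less_imp_le)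
      finally show ?thesis using True by (simp add: axis_def r_def)
    next
      case False
      then show ?thesis using elim(1) by (simp add: axis_def r_def less_imp_le)
    qed
    have ul: "uniform_limit (cball 0 \<rho>) (\<lambda>F t. \<Sum>I\<in>F. u I / of_nat (vfact I) * mpow (h + axis j t) I)
        (\<lambda>t. series_eval u (h + axis j t)) (finite_subsets_at_top UNIV)"
    proof (rule Weierstrass_m_test_general'[where M = "\<lambda>I. A * (1/2) ^ msize I"])
      show "norm (u I / of_nat (vfact I) * mpow (h + axis j t) I) \<le> A * (1/2) ^ msize I"
        if "t \<in> cball 0 \<rho>" for I t
        by (rule series_eval_term_bound[OF AB(3,1,2) small[OF that]])
      show "((\<lambda>I. u I / of_nat (vfact I) * mpow (h + axis j t) I) has_sum series_eval u (h +
        axis j t)) UNIV"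
        if "t \<in> cball 0 \<rho>" for t
        by (rule series_eval_has_sum_explicit[OF AB(3,1,2) small[OF that]])
    qed (rule half_summable)
    define f' where "f' F t = (\<Sum>I\<in>F. u I / of_nat (vfact I) * (of_nat (I $ j) * (h $ j +
      t) ^ (I $ j - 1) * rest I))"
      for F t
    have der: "((\<lambda>t. \<Sum>I\<in>F. u I / of_nat (vfact I) * mpow (h +
      axis j t) I) has_field_derivative f' F t) (at t)" for F t
      unfolding f'_def mp by (rule DERIV_sum) (auto intro!: derivative_eq_intros)
    obtain g' where g': "\<And>w. w \<in> ball 0 \<rho> \<Longrightarrow> ((\<lambda>t. series_eval u (h +
      axis j t)) has_field_derivative (g' w)) (at w) \<and>
        ((\<lambda>F. f' F w) \<longlongrightarrow> g' w) (finite_subsets_at_top UNIV)"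
    proof (rule has_complex_derivative_uniform_limit[OF _ ul _ \<open>\<rho> > 0\<close>, where f' = f'])
      show "\<forall>\<^sub>F F in finite_subsets_at_top UNIV.
         continuous_on (cball 0 \<rho>) (\<lambda>t. \<Sum>I\<in>F. u I / of_nat (vfact I) * mpow (h + axis j t) I) \<and>
         (\<forall>w\<in>ball 0 \<rho>. ((\<lambda>t. \<Sum>I\<in>F. u I / of_nat (vfact I) * mpow (h +
           axis j t) I) has_field_derivative f' F w) (at w))"
        using der by (intro always_eventually allI conjI ballI DERIV_continuous_on)
          (auto intro: has_field_derivative_at_within)
      show "finite_subsets_at_top (UNIV :: (nat ^ 'n) set) \<noteq> bot"
        by simp
    qed (use that in blast)
    have "((\<lambda>I. u I / of_nat (vfact I) * (of_nat (I $ j) * (h $ j +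
      0) ^ (I $ j - 1) * rest I)) has_sum g' 0) UNIV"
      unfolding has_sum_def using g'[of 0] \<open>\<rho> > 0\<close> by (simp add: f'_def)
    also have "(\<lambda>I. u I / of_nat (vfact I) * (of_nat (I $ j) * (h $ j +
      0) ^ (I $ j - 1) * rest I)) =
        (\<lambda>I. of_nat (I $ j) * u I / of_nat (vfact I) * (h $ j ^ (I $ j - 1) * rest I))"
      by (simp add: mult_ac)
    finally have "((\<lambda>I. u (I + axis j 1) / of_nat (vfact I) * mpow h I) has_sum g' 0) UNIV"
      by (simp only: has_sum_ev_shift rest_def)
    then have "g' 0 = series_eval (\<lambda>I. u (I + axis j 1)) h"
      using elim(2) has_sum_unique by blast
    then show ?case
      using g'[of 0] \<open>\<rho> > 0\<close> by simp
  qed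
qed

lemma series_eval_index_mult:
  fixes u :: "nat ^ 'n::finite \<Rightarrow> complex"
  assumes "convergent_coeffs u"
  shows "\<forall>\<^sub>F h in nhds 0. series_eval (\<lambda>I. of_nat (I $ j) * u I) h = h $ j * series_eval (\<lambda>I. u (I +
    axis j 1)) h"
proof -
  have "\<forall>\<^sub>F h in nhds 0. ((\<lambda>I. u (I +
    axis j 1) / of_nat (vfact I) * mpow h I) has_sum series_eval (\<lambda>I. u (I + axis j 1)) h) UNIV"
    by (rule convergent_coeffs_has_sum) (rule convergent_coeffs_shift[OF assms])
  then show ?thesis
  proof eventually_elim
    case (elim h)
    then have "((\<lambda>I. h $ j * (of_nat (I $ j) * u I / of_nat (vfact I) *
      (h $ j ^ (I $ j - 1) * (\<Prod>i\<in>UNIV - {j}. h $ i ^ (I $ i))))) has_sum (h $ j * series_eval (\<lambda>I. u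
        (I + axis j 1)) h)) UNIV"
      unfolding has_sum_ev_shift by (rule has_sum_cmult_right)
    also have "(\<lambda>I. h $ j * (of_nat (I $ j) * u I / of_nat (vfact I) *
      (h $ j ^ (I $ j - 1) * (\<Prod>i\<in>UNIV - {j}. h $ i ^ (I $ i))))) =
        (\<lambda>I. of_nat (I $ j) * u I / of_nat (vfact I) * mpow h I)"
    proof
      fix I
      have "mpow h I = h $ j ^ (I $ j) * (\<Prod>i\<in>UNIV - {j}. h $ i ^ (I $ i))"
        unfolding mpow_def by (subst prod.remove[of UNIV j]) auto
      then show "h $ j * (of_nat (I $ j) * u I / of_nat (vfact I) *
          (h $ j ^ (I $ j - 1) * (\<Prod>i\<in>UNIV - {j}. h $ i ^ (I $ i)))) =
            of_nat (I $ j) * u I / of_nat (vfact I) * mpow h I"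
        by (cases "I $ j") auto
    qed
    finally show ?case
      unfolding series_eval_def by (rule infsumI)
  qed
qed

lemma series_eval_add:
  assumes "convergent_coeffs u" "convergent_coeffs v"
  shows "\<forall>\<^sub>F h in nhds 0. series_eval (\<lambda>I. u I + v I) h = series_eval u h + series_eval v h"
  using convergent_coeffs_has_sum[OF assms(1)] convergent_coeffs_has_sum[OF assms(2)]
proof eventually_elim
  case (elim h)
  then show ?case
    using infsumI[OF has_sum_add[OF elim]] by (simp add: series_eval_def ring_distribs
      add_divide_distrib)
qed

lemma series_eval_scale: "series_eval (\<lambda>I. c * u I) h = c * series_eval u h"
  unfolding series_eval_def by (subst infsum_cmult_right'[symmetric]) (simp add: mult_ac)

lemma series_eval_0 [simp]: "series_eval (\<lambda>I. 0) h = 0"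
  by (simp add: series_eval_def)

lemma series_eval_sum:
  assumes "finite S" "\<And>k. k \<in> S \<Longrightarrow> convergent_coeffs (u k)"
  shows "\<forall>\<^sub>F h in nhds 0. series_eval (\<lambda>I. \<Sum>k\<in>S. u k I) h = (\<Sum>k\<in>S. series_eval (u k) h)"
  using assms
proof (induction S rule: finite_induct)
  case (insert k S)
  then have "\<forall>\<^sub>F h in nhds 0. series_eval (\<lambda>I. u k I + (\<Sum>k\<in>S. u k I)) h = series_eval (u k) h +
    series_eval (\<lambda>I. \<Sum>k\<in>S. u k I) h"
    by (intro series_eval_add convergent_coeffs_sum) auto
  moreover have "\<forall>\<^sub>F h in nhds 0. series_eval (\<lambda>I. \<Sum>k\<in>S. u k I) h = (\<Sum>k\<in>S. series_eval (u k) h)"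
    using insert by auto
  ultimately show ?case
    by eventually_elim (use insert in simp)
qed simp

section \<open>Germs, their Taylor coefficients, and the Mellin equations\<close>

text \<open>Links a germ to its family of derivatives, so that differential operators become
  operations on families and equality of germs becomes equality of families.\<close>

definition has_taylor :: "(complex ^ 'n::finite \<Rightarrow> complex) \<Rightarrow> complex ^ 'n \<Rightarrow> (nat ^ 'n \<Rightarrow> complex) \<Rightarrow>
    bool" where
  "has_taylor f a u \<longleftrightarrow> convergent_coeffs u \<and> (\<forall>\<^sub>F x in nhds a. f x = series_eval u (x - a))"

lemma eventually_nhds_translate:
  fixes a :: "'a::real_normed_vector"
  assumes "\<forall>\<^sub>F h in nhds 0. P h"
  shows "\<forall>\<^sub>F x in nhds a. P (x - a)"
proof (rule eventually_compose_filterlim[OF assms])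
  have "filterlim (\<lambda>x. x - a) (nhds (a - a)) (nhds a)"
    by (intro tendsto_diff tendsto_const filterlim_ident)
  then show "filterlim (\<lambda>x. x - a) (nhds 0) (nhds a)"
    by simp
qed

text \<open>Abel's argument: summability at one point with all coordinates of \<open>x - a\<close>
  nonzero bounds the terms there, and this already gives Cauchy estimates.\<close>

lemma mv_analytic_at_iff: "mv_analytic_at f a \<longleftrightarrow> (\<exists>u. has_taylor f a u)"
proof
  assume "mv_analytic_at f a"
  then obtain c where c: "\<forall>\<^sub>F x in nhds a. ((\<lambda>I. c I * mpow (x - a) I) has_sum f x) UNIV"
    unfolding mv_analytic_at_def by auto
  \<comment> \<open>The test points approach \<open>a\<close> along the diagonal: with all
    coordinates equal to \<open>r\<close> the monomial is \<open>r ^ msize I\<close>. The later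
    restriction \<open>r < 1\<close> provides the base \<open>1 / r \<ge> 1\<close>.\<close>
  have "filterlim (\<lambda>r::real. a + (\<chi> j. of_real r)) (nhds (a + (\<chi> j. of_real 0))) (at_right 0)"
    by (intro tendsto_add tendsto_const vec_tendstoI)
       (unfold vec_lambda_beta, intro tendsto_of_real tendsto_ident_at)
  also have "a + (\<chi> j. of_real 0) = a"
    by (simp add: vec_eq_iff)
  finally have "\<forall>\<^sub>F r::real in at_right 0. ((\<lambda>I. c I * mpow ((a +
    (\<chi> j. of_real r)) - a) I) has_sum f (a + (\<chi> j. of_real r))) UNIV"
    by (rule eventually_compose_filterlim[OF c])
  moreover have "\<forall>\<^sub>F r::real in at_right 0. 0 < r \<and> r < 1"
    unfolding eventually_at_right_field by (intro exI[of _ 1]) auto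
  ultimately have series_eval: "\<forall>\<^sub>F r::real in at_right 0. 0 < r \<and> r < 1 \<and>
      ((\<lambda>I. c I * mpow ((a + (\<chi> j. of_real r)) - a) I) has_sum f (a + (\<chi> j. of_real r))) UNIV"
    by eventually_elim auto
  then obtain r :: real where r: "0 < r" "r < 1"
      "((\<lambda>I. c I * mpow ((a + (\<chi> j. of_real r)) - a) I) has_sum f (a + (\<chi> j. of_real r))) UNIV"
    using eventually_happens[OF series_eval] by auto
  have mp: "mpow ((a + (\<chi> j. of_real r)) - a) I = of_real r ^ msize I" for I
    by (simp add: mpow_def msize_def power_sum)
  define A where "A = (\<Sum>\<^sub>\<infinity>I. norm (c I * of_real r ^ msize I))"
  have "(\<lambda>I. c I * of_real r ^ msize I) summable_on UNIV"
    using r(3) unfolding mp by (rule has_sum_imp_summable)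
  then have sm: "(\<lambda>I. norm (c I * of_real r ^ msize I)) summable_on UNIV"
    by (simp only: summable_on_iff_abs_summable_on_complex)
  have A: "norm (c I * of_real r ^ msize I) \<le> A" for I
    using finite_sum_le_infsum[OF sm, of "{I}"] by (simp add: A_def)
  have "A \<ge> 0" unfolding A_def by (intro infsum_nonneg) auto
  define u where "u I = c I * of_nat (vfact I)" for I
  have "norm (u I) \<le> A * (1 / r) ^ msize I * vfact I" for I
  proof -
    have "norm (c I) * r ^ msize I \<le> A"
      using A[of I] r by (simp add: norm_mult norm_power)
    then have "norm (c I) \<le> A * (1 / r) ^ msize I"
      using r by (simp add: field_simps power_one_over)
    then show ?thesis
      using mult_right_mono[of "norm (c I)" "A * (1 / r) ^ msize I" "vfact I"] by (simp add: u_def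
        norm_mult)
  qed
  then have "convergent_coeffs u"
    unfolding convergent_coeffs_def using \<open>A \<ge> 0\<close> r by (intro exI[of _ A] conjI exI[of _ "1 / r"])
      auto
  moreover have "\<forall>\<^sub>F x in nhds a. f x = series_eval u (x - a)"
    using c by eventually_elim (auto simp: series_eval_def u_def infsumI)
  ultimately show "\<exists>u. has_taylor f a u"
    unfolding has_taylor_def by auto
next
  assume "\<exists>u. has_taylor f a u"
  then obtain u where u: "convergent_coeffs u" "\<forall>\<^sub>F x in nhds a. f x = series_eval u (x - a)"
    unfolding has_taylor_def by auto
  have "\<forall>\<^sub>F x in nhds a. ((\<lambda>I. u I / of_nat (vfact I) * mpow (x - a) I) has_sum series_eval u (x -
    a)) UNIV"
    using eventually_nhds_translate[OF convergent_coeffs_has_sum[OF u(1)]] .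
  with u(2) have "\<forall>\<^sub>F x in nhds a. ((\<lambda>I. u I / of_nat (vfact I) * mpow (x - a) I) has_sum f x) UNIV"
    by eventually_elim simp
  then show "mv_analytic_at f a"
    unfolding mv_analytic_at_def by (intro exI[of _ "\<lambda>I. u I / of_nat (vfact I)"])
qed

lemma has_taylor_value: "has_taylor f a u \<Longrightarrow> f a = u 0"
  unfolding has_taylor_def by (auto simp: series_eval_zero dest: eventually_nhds_x_imp_x)

lemma has_taylor_geo: "has_taylor f a u \<Longrightarrow> convergent_coeffs u"
  by (simp add: has_taylor_def)

lemma has_taylor_cong:
  assumes "has_taylor f a u" "\<forall>\<^sub>F x in nhds a. g x = f x"
  shows "has_taylor g a u"
proof -
  have "\<forall>\<^sub>F x in nhds a. f x = series_eval u (x - a)"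
    using assms(1) by (simp add: has_taylor_def)
  with assms(2) have "\<forall>\<^sub>F x in nhds a. g x = series_eval u (x - a)"
    by eventually_elim simp
  with assms(1) show ?thesis
    by (simp add: has_taylor_def)
qed

lemma has_taylor_eq:
  assumes "has_taylor f a u" "has_taylor g a u"
  shows "\<forall>\<^sub>F x in nhds a. f x = g x"
proof -
  have "\<forall>\<^sub>F x in nhds a. f x = series_eval u (x - a)" "\<forall>\<^sub>F x in nhds a. g x = series_eval u (x - a)"
    using assms by (simp_all add: has_taylor_def)
  then show ?thesis
    by eventually_elim simp
qed

lemma has_taylor_partial_deriv:
  assumes "has_taylor f a u"
  shows "has_taylor (partial_deriv j f) a (\<lambda>I. u (I + axis j 1))"
proof -
  \<comment> \<open>The derivative at \<open>x\<close> sees \<open>f\<close> on a neighbourhood of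
    \<open>x\<close>, so agreement with the series is needed near every \<open>x\<close> close to
    \<open>a\<close>.\<close>
  have "\<forall>\<^sub>F x in nhds a. \<forall>\<^sub>F y in nhds x. f y = series_eval u (y - a)"
    using assms by (simp add: has_taylor_def eventually_eventually)
  moreover have "\<forall>\<^sub>F x in nhds a. ((\<lambda>t. series_eval u ((x - a) +
    axis j t)) has_field_derivative series_eval (\<lambda>I. u (I + axis j 1)) (x - a)) (at 0)"
    using assms by (intro eventually_nhds_translate series_eval_deriv) (simp add: has_taylor_def)
  ultimately have "\<forall>\<^sub>F x in nhds a. partial_deriv j f x = series_eval (\<lambda>I. u (I +
    axis j 1)) (x - a)"
  proof eventually_elim
    case (elim x)
    have "((\<lambda>t. axis j t $ i) \<longlongrightarrow> axis j 0 $ i) (nhds (0 :: complex))" for i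
      by (cases "i = j") (auto simp: axis_def filterlim_ident)
    then have "filterlim (\<lambda>t :: complex. x + axis j t) (nhds (x + axis j 0)) (nhds 0)"
      by (intro tendsto_add tendsto_const vec_tendstoI)
    moreover have "x + axis j 0 = x"
      by (simp add: vec_eq_iff axis_def)
    ultimately have "\<forall>\<^sub>F t in nhds 0. f (x + axis j t) = series_eval u ((x + axis j t) - a)"
      using eventually_compose_filterlim[OF elim(1)] by simp
    then have "\<forall>\<^sub>F t in nhds 0. f (x + axis j t) = series_eval u ((x - a) + axis j t)"
      by (simp add: algebra_simps)
    then have "((\<lambda>t. f (x + axis j t)) has_field_derivative series_eval (\<lambda>I. u (I +
      axis j 1)) (x - a)) (at 0)"
      using elim(2) by (subst DERIV_cong_ev) auto
    then show ?case
      unfolding partial_deriv_def by (rule DERIV_imp_deriv)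
  qed
  with assms show ?thesis
    by (auto simp: has_taylor_def intro: convergent_coeffs_shift)
qed

lemma has_taylor_partial_deriv_iter:
  fixes u :: "nat ^ 'n::finite \<Rightarrow> complex"
  assumes "has_taylor f a u"
  shows "has_taylor ((partial_deriv j ^^ k) f) a (\<lambda>I. u (I + axis j k))"
proof (induction k)
  case 0
  have "axis j 0 = (0 :: nat ^ 'n)" by (simp add: vec_eq_iff axis_def)
  then show ?case using assms by (simp only: add_0_right funpow_0)
next
  case (Suc k)
  have "axis j 1 + axis j k = axis j (Suc k)" by (simp add: vec_eq_iff axis_def)
  with has_taylor_partial_deriv[OF Suc, of j] show ?case
    by (simp add: add.assoc)
qed

lemma has_taylor_add:
  assumes "has_taylor f a u" "has_taylor g a v"
  shows "has_taylor (\<lambda>x. f x + g x) a (\<lambda>I. u I + v I)"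
proof -
  have "\<forall>\<^sub>F x in nhds a. series_eval (\<lambda>I. u I + v I) (x - a) = series_eval u (x - a) +
    series_eval v (x - a)"
    using assms by (intro eventually_nhds_translate series_eval_add) (auto simp: has_taylor_def)
  moreover have "\<forall>\<^sub>F x in nhds a. f x = series_eval u (x - a)" "\<forall>\<^sub>F x in nhds a. g x =
    series_eval v (x - a)"
    using assms by (simp_all add: has_taylor_def)
  ultimately have "\<forall>\<^sub>F x in nhds a. f x + g x = series_eval (\<lambda>I. u I + v I) (x - a)"
    by eventually_elim simp
  with assms show ?thesis
    by (auto simp: has_taylor_def intro: convergent_coeffs_add)
qed

lemma has_taylor_scale:
  assumes "has_taylor f a u"
  shows "has_taylor (\<lambda>x. c * f x) a (\<lambda>I. c * u I)"
proof -
  have "\<forall>\<^sub>F x in nhds a. f x = series_eval u (x - a)"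
    using assms by (simp_all add: has_taylor_def)
  then have "\<forall>\<^sub>F x in nhds a. c * f x = series_eval (\<lambda>I. c * u I) (x - a)"
    by eventually_elim (simp add: series_eval_scale)
  with assms show ?thesis
    by (auto simp: has_taylor_def intro: convergent_coeffs_scale)
qed

lemma has_taylor_0: "has_taylor (\<lambda>x. 0) a (\<lambda>I. 0)"
  by (simp add: has_taylor_def)

lemma has_taylor_sum:
  assumes "\<And>k. k \<in> S \<Longrightarrow> has_taylor (f k) a (u k)"
  shows "has_taylor (\<lambda>x. \<Sum>k\<in>S. f k x) a (\<lambda>I. \<Sum>k\<in>S. u k I)"
  using assms by (induction S rule: infinite_finite_induct) (auto intro: has_taylor_0
    has_taylor_add)

text \<open>From \<open>\<partial>\<^sup>J (x\<^sub>i \<partial>\<^sub>i f) = x\<^sub>i \<partial>\<^sup>J \<partial>\<^sub>i f + J\<^sub>i \<partial>\<^sup>J f\<close>.\<close>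
definition theta_coeff :: "'n::finite \<Rightarrow> complex ^ 'n \<Rightarrow> (nat ^ 'n \<Rightarrow> complex) \<Rightarrow> nat ^ 'n \<Rightarrow> complex"
    where
  "theta_coeff i x u J = x $ i * u (J + axis i 1) + of_nat (J $ i) * u J"

definition theta_form_coeff :: "('n::finite \<Rightarrow> nat) \<Rightarrow> complex \<Rightarrow> complex ^ 'n \<Rightarrow> (nat ^ 'n \<Rightarrow> complex) \<Rightarrow>
    nat ^ 'n \<Rightarrow> complex" where
  "theta_form_coeff a c x u J = (\<Sum>i\<in>UNIV. of_nat (a i) * theta_coeff i x u J) + c * u J"

text \<open>Split \<open>x $ i\<close> as \<open>a $ i + (x - a) $ i\<close>: the first summand only
  rescales the partial derivative, the second multiplies the \<open>I\<close>-th coefficient by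
  \<open>I $ i\<close>.\<close>

lemma has_taylor_theta:
  assumes "has_taylor f a u"
  shows "has_taylor (theta i f) a (theta_coeff i a u)"
proof -
  let ?s = "\<lambda>I. u (I + axis i 1)"
  have "convergent_coeffs u" using assms by (rule has_taylor_geo)
  have g: "has_taylor (\<lambda>x. series_eval (\<lambda>I. of_nat (I $ i) * u I) (x - a)) a (\<lambda>I. of_nat (I $ i) * u
    I)"
    using \<open>convergent_coeffs u\<close> by (simp add: has_taylor_def convergent_coeffs_index_mult)
  have r: "has_taylor (\<lambda>x. a $ i * partial_deriv i f x +
    series_eval (\<lambda>I. of_nat (I $ i) * u I) (x - a)) a (theta_coeff i a u)"
    unfolding theta_coeff_def[abs_def]
    by (rule has_taylor_add[OF has_taylor_scale[OF has_taylor_partial_deriv[OF assms]] g])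
  show ?thesis
  proof (rule has_taylor_cong[OF r])
    have "\<forall>\<^sub>F x in nhds a. partial_deriv i f x = series_eval ?s (x - a)"
      using has_taylor_partial_deriv[OF assms] by (simp add: has_taylor_def)
    moreover have "\<forall>\<^sub>F x in nhds a. series_eval (\<lambda>I. of_nat (I $ i) * u I) (x - a) =
      (x - a) $ i * series_eval ?s (x - a)"
      by (intro eventually_nhds_translate series_eval_index_mult \<open>convergent_coeffs u\<close>)
    ultimately show "\<forall>\<^sub>F x in nhds a. theta i f x = a $ i * partial_deriv i f x +
      series_eval (\<lambda>I. of_nat (I $ i) * u I) (x - a)"
      by eventually_elim (simp add: theta_def algebra_simps)
  qed
qed

lemma has_taylor_theta_form:
  assumes "has_taylor f x0 u"
  shows "has_taylor (theta_form a c f) x0 (theta_form_coeff a c x0 u)"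
  unfolding theta_form_def[abs_def] theta_form_coeff_def[abs_def]
  by (intro has_taylor_add has_taylor_sum has_taylor_scale has_taylor_theta assms)

lemma convergent_coeffs_tf: "convergent_coeffs u \<Longrightarrow> convergent_coeffs (theta_form_coeff a c x u)"
proof -
  assume "convergent_coeffs u"
  then have "has_taylor (\<lambda>y. series_eval u (y - x)) x u" by (simp add: has_taylor_def)
  from has_taylor_geo[OF has_taylor_theta_form[OF this]] show ?thesis .
qed

definition theta_forms_coeff :: "(('n::finite \<Rightarrow> nat) \<times> complex) list \<Rightarrow> complex ^ 'n \<Rightarrow> (nat ^ 'n \<Rightarrow>
    complex) \<Rightarrow> nat ^ 'n \<Rightarrow> complex" where
  "theta_forms_coeff ops x u = foldr (\<lambda>(a, c). theta_form_coeff a c x) ops u"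

lemma theta_forms_coeff_simps [simp]: "theta_forms_coeff [] x u =
    u" "theta_forms_coeff ((a, c) # ops) x u = theta_form_coeff a c x (theta_forms_coeff ops x u)"
  by (simp_all add: theta_forms_coeff_def)

lemma convergent_coeffs_tfs: "convergent_coeffs u \<Longrightarrow> convergent_coeffs (theta_forms_coeff ops x u)"
  by (induction ops) (auto intro: convergent_coeffs_tf)

lemma has_taylor_foldr:
  assumes "has_taylor f x0 u"
  shows "has_taylor (foldr (\<lambda>(a, c). theta_form a c) ops f) x0 (theta_forms_coeff ops x0 u)"
  by (induction ops) (auto intro: has_taylor_theta_form assms)

text \<open>The value at \<open>a\<close> gives the entry 0; every other entry is reached by
  differentiating, because all partial derivatives of the zero function vanish.\<close>

lemma has_taylor_zero_unique:
  assumes "has_taylor (\<lambda>x. 0) a u"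
  shows "u I = 0"
  using assms
proof (induction "msize I" arbitrary: u I)
  case 0
  then show ?case using has_taylor_value[of "\<lambda>x. 0" a u] by (simp add: msize_eq_0_iff)
next
  case (Suc k)
  then obtain j where j: "I $ j \<noteq> 0"
    unfolding msize_def by (metis nat.distinct(1) sum.neutral)
  define I' where "I' = I - axis j 1"
  have I: "I = I' + axis j 1"
    using j by (auto simp: I'_def vec_eq_iff axis_def)
  have "partial_deriv j (\<lambda>x. 0) = (\<lambda>x. 0)"
    by (simp add: partial_deriv_def fun_eq_iff)
  then have "has_taylor (\<lambda>x. 0) a (\<lambda>I. u (I + axis j 1))"
    using has_taylor_partial_deriv[OF Suc.prems, of j] by simp
  moreover have "k = msize I'"
    using Suc(2) by (simp add: I msize_add)
  ultimately show ?case
    unfolding I using Suc(1) by auto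
qed

lemma has_taylor_unique:
  assumes "has_taylor f a u" "has_taylor g a v" "\<forall>\<^sub>F x in nhds a. f x = g x"
  shows "u = v"
proof -
  have "has_taylor (\<lambda>x. f x + (-1) * g x) a (\<lambda>I. u I + (-1) * v I)"
    by (intro has_taylor_add has_taylor_scale assms)
  moreover have "\<forall>\<^sub>F x in nhds a. 0 = f x + (-1) * g x"
    using assms(3) by eventually_elim simp
  ultimately have "has_taylor (\<lambda>x. 0) a (\<lambda>I. u I + (-1) * v I)"
    by (rule has_taylor_cong)
  from has_taylor_zero_unique[OF this] show ?thesis
    by auto
qed

text \<open>These are the derivatives at \<open>h\<close> of the function whose Taylor coefficients
  at 0 are \<open>u\<close>. Nothing is claimed about resumming them around \<open>h\<close>: the
  equations below involve finitely many entries at a time, each controlled on its own neighbourhood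
  of 0.\<close>

definition jet :: "(nat ^ 'n::finite \<Rightarrow> complex) \<Rightarrow> complex ^ 'n \<Rightarrow> nat ^ 'n \<Rightarrow> complex" where
  "jet u h K = series_eval (\<lambda>I. u (I + K)) h"

lemma jet_th:
  assumes "convergent_coeffs u"
  shows "\<forall>\<^sub>F h in nhds 0. jet (theta_coeff i 0 u) h K = theta_coeff i h (jet u h) K"
proof -
  define v where "v I = u (I + K)" for I
  have "convergent_coeffs v" unfolding v_def by (rule convergent_coeffs_shift[OF assms])
  have 1: "(\<lambda>I. theta_coeff i 0 u (I + K)) = (\<lambda>I. of_nat (I $ i) * v I + of_nat (K $ i) * v I)"
    by (auto simp: theta_coeff_def v_def algebra_simps)
  have 2: "(\<lambda>I. v (I + axis i 1)) = (\<lambda>I. u (I + (K + axis i 1)))"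
    by (simp add: v_def ac_simps)
  have "\<forall>\<^sub>F h in nhds 0. series_eval (\<lambda>I. of_nat (I $ i) * v I + of_nat (K $ i) * v I) h =
      series_eval (\<lambda>I. of_nat (I $ i) * v I) h + series_eval (\<lambda>I. of_nat (K $ i) * v I) h"
    by (intro series_eval_add convergent_coeffs_index_mult convergent_coeffs_scale
      \<open>convergent_coeffs v\<close>)
  moreover have "\<forall>\<^sub>F h in nhds 0. series_eval (\<lambda>I. of_nat (I $ i) * v I) h =
    h $ i * series_eval (\<lambda>I. v (I + axis i 1)) h"
    by (intro series_eval_index_mult \<open>convergent_coeffs v\<close>)
  ultimately show ?thesis
  proof eventually_elim
    case (elim h)
    have "jet (theta_coeff i 0 u) h K = h $ i * series_eval (\<lambda>I. u (I + (K + axis i 1))) h +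
      of_nat (K $ i) * series_eval v h"
      unfolding jet_def 1 elim 2 by (simp only: series_eval_scale)
    then show ?case
      by (simp add: theta_coeff_def jet_def v_def[abs_def])
  qed
qed

lemma jet_tf:
  assumes "convergent_coeffs u"
  shows "\<forall>\<^sub>F h in nhds 0. jet (theta_form_coeff a c 0 u) h K = theta_form_coeff a c h (jet u h) K"
proof -
  let ?r = "\<lambda>v h. series_eval (\<lambda>I. v (I + K)) h"
  have gth: "convergent_coeffs (theta_coeff i 0 u)" for i
  proof -
    have "has_taylor (\<lambda>y. series_eval u (y - 0)) 0 u" using assms by (simp add: has_taylor_def)
    from has_taylor_geo[OF has_taylor_theta[OF this]] show ?thesis .
  qed
  have "\<forall>\<^sub>F h in nhds 0. \<forall>i\<in>UNIV. jet (theta_coeff i 0 u) h K = theta_coeff i h (jet u h) K"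
    by (intro eventually_ball_finite ballI jet_th assms) simp
  moreover have "\<forall>\<^sub>F h in nhds 0. series_eval (\<lambda>I. (\<Sum>i\<in>UNIV. of_nat (a i) * theta_coeff i 0 u (I +
    K)) + c * u (I + K)) h =
      series_eval (\<lambda>I. \<Sum>i\<in>UNIV. of_nat (a i) * theta_coeff i 0 u (I + K)) h +
        series_eval (\<lambda>I. c * u (I + K)) h"
    by (intro series_eval_add convergent_coeffs_sum convergent_coeffs_scale convergent_coeffs_shift
      gth assms)
  moreover have "\<forall>\<^sub>F h in nhds 0. series_eval (\<lambda>I. \<Sum>i\<in>UNIV. of_nat (a i) * theta_coeff i 0 u (I +
    K)) h =
      (\<Sum>i\<in>UNIV. series_eval (\<lambda>I. of_nat (a i) * theta_coeff i 0 u (I + K)) h)"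
    by (intro series_eval_sum convergent_coeffs_scale convergent_coeffs_shift gth) auto
  ultimately show ?thesis
    by eventually_elim (simp add: jet_def theta_form_coeff_def series_eval_scale)
qed

text \<open>A theta form at \<open>K\<close> reads the entries \<open>K\<close> and
  \<open>K + axis i 1\<close>, hence the induction for all \<open>K\<close>. Each step intersects
  finitely many neighbourhoods.\<close>

lemma jet_tfs:
  assumes "convergent_coeffs u"
  shows "\<forall>\<^sub>F h in nhds 0. jet (theta_forms_coeff ops 0 u) h K = theta_forms_coeff ops h (jet u h) K"
proof (induction ops arbitrary: K)
  case (Cons op ops)
  obtain a c where op: "op = (a, c)" by force
  have "\<forall>\<^sub>F h in nhds 0. jet (theta_form_coeff a c 0 (theta_forms_coeff ops 0 u)) h K =
    theta_form_coeff a c h (jet (theta_forms_coeff ops 0 u) h) K"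
    by (intro jet_tf convergent_coeffs_tfs assms)
  moreover have "\<forall>\<^sub>F h in nhds 0. \<forall>i\<in>UNIV. jet (theta_forms_coeff ops 0 u) h (K + axis i 1) =
    theta_forms_coeff ops h (jet u h) (K + axis i 1)"
    by (intro eventually_ball_finite ballI Cons.IH) simp
  moreover have "\<forall>\<^sub>F h in nhds 0. jet (theta_forms_coeff ops 0 u) h K =
    theta_forms_coeff ops h (jet u h) K"
    by (rule Cons.IH)
  ultimately show ?case
    unfolding op theta_forms_coeff_simps
  proof eventually_elim
    case (elim h)
    have "theta_form_coeff a c h (jet (theta_forms_coeff ops 0 u) h) K =
      theta_form_coeff a c h (theta_forms_coeff ops h (jet u h)) K"
      unfolding theta_form_coeff_def theta_coeff_def using elim(2,3) by simp
    with elim(1) show ?case by (rule trans)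
  qed
qed simp

lemma jet_0: "jet u 0 = u"
  by (simp add: jet_def series_eval_zero fun_eq_iff)

section \<open>The Mellin equations as relations between Taylor coefficients\<close>

definition mellin_factors :: "nat \<Rightarrow> ('n::finite \<Rightarrow> nat) \<Rightarrow> 'n \<Rightarrow> (('n \<Rightarrow> nat) \<times> complex) list" where
  "mellin_factors m mm j = map (\<lambda>k. (mm, of_nat (m * k) + 1)) [0..<mm j] @
     map (\<lambda>k. (\<lambda>i. m - mm i, of_nat (m * k) - 1)) [0..<m - mm j]"

text \<open>The \<open>J\<close>-th derivative of the \<open>j\<close>-th equation evaluated at
  \<open>x\<close>. As a finite relation it makes sense for every family \<open>u\<close>, in
  particular for formal solutions and for jets.\<close>

definition mellin_equation :: "nat \<Rightarrow> ('n::finite \<Rightarrow> nat) \<Rightarrow> complex ^ 'n \<Rightarrow> (nat ^ 'n \<Rightarrow> complex) \<Rightarrow> 'n \<Rightarrow>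
    nat ^ 'n \<Rightarrow> bool" where
  "mellin_equation m mm x u j J \<longleftrightarrow> theta_forms_coeff (mellin_factors m mm j) x u J =
    (- 1) ^ mm j * of_nat m ^ m * u (J + axis j m)"

lemma op_prod_eq_foldr: "op_prod N L f = foldr L [0..<N] f"
proof -
  have "foldr (\<circ>) (map L xs) id f = foldr L xs f" for xs
    by (induction xs) auto
  then show ?thesis by (simp add: op_prod_def)
qed

lemma mellin_lhs_eq_foldr: "mellin_lhs m mm j y = foldr (\<lambda>(a, c). theta_form a c) (mellin_factors m
    mm j) y"
  by (simp add: mellin_lhs_def op_prod_eq_foldr mellin_factors_def foldr_map o_def)

lemma mellin_solutions_iff:
  assumes "has_taylor y a u"
  shows "y \<in> mellin_solutions m mm a \<longleftrightarrow> (\<forall>j J. mellin_equation m mm a u j J)"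
proof -
  let ?l = "\<lambda>j. theta_forms_coeff (mellin_factors m mm j) a u" and ?r =
    "\<lambda>j J. (- 1) ^ mm j * of_nat m ^ m * u (J + axis j m)"
  have l: "has_taylor (mellin_lhs m mm j y) a (?l j)" for j
    unfolding mellin_lhs_eq_foldr by (rule has_taylor_foldr[OF assms])
  have r: "has_taylor (\<lambda>x. (- 1) ^ mm j * of_nat m ^ m * (partial_deriv j ^^ m) y x) a (?r j)" for j
    by (intro has_taylor_scale has_taylor_partial_deriv_iter assms)
  have "y \<in> mellin_solutions m mm a \<longleftrightarrow>
      (\<forall>\<^sub>F x in nhds a. \<forall>j\<in>UNIV. mellin_lhs m mm j y x =
        (- 1) ^ mm j * of_nat m ^ m * (partial_deriv j ^^ m) y x)"
    using assms by (auto simp: mellin_solutions_def mv_analytic_at_iff)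
  also have "\<dots> \<longleftrightarrow> (\<forall>j\<in>UNIV. \<forall>\<^sub>F x in nhds a. mellin_lhs m mm j y x =
    (- 1) ^ mm j * of_nat m ^ m * (partial_deriv j ^^ m) y x)"
    by (rule eventually_ball_finite_distrib) simp
  also have "\<dots> \<longleftrightarrow> (\<forall>j\<in>UNIV. ?l j = ?r j)"
  proof (intro ball_cong refl iffI)
    fix j assume "\<forall>\<^sub>F x in nhds a. mellin_lhs m mm j y x =
      (- 1) ^ mm j * of_nat m ^ m * (partial_deriv j ^^ m) y x"
    then show "?l j = ?r j"
      by (rule has_taylor_unique[OF l r])
  next
    fix j assume "?l j = ?r j"
    then show "\<forall>\<^sub>F x in nhds a. mellin_lhs m mm j y x =
      (- 1) ^ mm j * of_nat m ^ m * (partial_deriv j ^^ m) y x"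
      using has_taylor_eq[OF l r[of j, folded \<open>?l j = ?r j\<close>]] by simp
  qed
  finally show ?thesis
    by (simp add: mellin_equation_def fun_eq_iff)
qed

section \<open>Polynomials, elimination, and normal ordering of the theta operators\<close>

text \<open>Sums and products produce repeated exponents; collecting the fibres of \<open>g\<close>
  restores the form required by \<open>mv_polynomial\<close>.\<close>

lemma mv_polynomial_family:
  assumes "finite S"
  shows "mv_polynomial (\<lambda>x. \<Sum>k\<in>S. c k * mpow x (g k))"
  unfolding mv_polynomial_def
proof (intro exI conjI)
  show "finite (g ` S)" using assms by simp
  show "(\<lambda>x. \<Sum>k\<in>S. c k * mpow x (g k)) = (\<lambda>x. \<Sum>I\<in>g ` S. (\<Sum>k | k \<in> S \<and> g k = I. c k) * mpow x I)"
  proof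
    fix x
    have "(\<Sum>k\<in>S. c k * mpow x (g k)) = (\<Sum>I\<in>g ` S. \<Sum>k | k \<in> S \<and> g k = I. c k * mpow x (g k))"
      by (rule sum.image_gen[OF assms])
    also have "\<dots> = (\<Sum>I\<in>g ` S. (\<Sum>k | k \<in> S \<and> g k = I. c k) * mpow x I)"
      by (intro sum.cong refl) (simp add: sum_distrib_right)
    finally show "(\<Sum>k\<in>S. c k * mpow x (g k)) = \<dots>" .
  qed
qed

lemma mv_polynomial_const [intro]: "mv_polynomial (\<lambda>x. c)"
  using mv_polynomial_family[of "{()}" "\<lambda>_. c" "\<lambda>_. 0"] by simp

lemma mv_polynomial_coord [intro]: "mv_polynomial (\<lambda>x. x $ i)"
  using mv_polynomial_family[of "{()}" "\<lambda>_. 1" "\<lambda>_. axis i 1"] by simp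

lemma mv_polynomial_add [intro]:
  assumes "mv_polynomial f" "mv_polynomial g"
  shows "mv_polynomial (\<lambda>x. f x + g x)"
proof -
  obtain A c where f: "finite A" "f = (\<lambda>x. \<Sum>I\<in>A. c I * mpow x I)"
    using assms by (auto simp: mv_polynomial_def)
  obtain B d where g: "finite B" "g = (\<lambda>x. \<Sum>I\<in>B. d I * mpow x I)"
    using assms by (auto simp: mv_polynomial_def)
  have "mv_polynomial (\<lambda>x. \<Sum>k\<in>A <+> B. case_sum c d k * mpow x (case_sum id id k))"
    using f g by (intro mv_polynomial_family) auto
  then show ?thesis
    using f g by (simp add: sum.Plus)
qed

lemma mv_polynomial_mult [intro]:
  assumes "mv_polynomial f" "mv_polynomial g"
  shows "mv_polynomial (\<lambda>x. f x * g x)"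
proof -
  obtain A c where f: "finite A" "f = (\<lambda>x. \<Sum>I\<in>A. c I * mpow x I)"
    using assms by (auto simp: mv_polynomial_def)
  obtain B d where g: "finite B" "g = (\<lambda>x. \<Sum>I\<in>B. d I * mpow x I)"
    using assms by (auto simp: mv_polynomial_def)
  have "mv_polynomial (\<lambda>x. \<Sum>k\<in>A \<times> B. (c (fst k) * d (snd k)) * mpow x (fst k + snd k))"
    using f g by (intro mv_polynomial_family) auto
  also have "(\<lambda>x. \<Sum>k\<in>A \<times> B. (c (fst k) * d (snd k)) * mpow x (fst k + snd k)) = (\<lambda>x. f x * g x)"
    unfolding f g by (simp add: sum_product sum.cartesian_product mpow_add case_prod_beta mult_ac)
  finally show ?thesis .
qed

lemma mv_polynomial_minus [intro]:
  assumes "mv_polynomial f" "mv_polynomial g"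
  shows "mv_polynomial (\<lambda>x. f x - g x)"
  using mv_polynomial_add[OF assms(1) mv_polynomial_mult[OF mv_polynomial_const[of "-1"] assms(2)]]
    by simp

lemma mv_polynomial_sum [intro]:
  assumes "\<And>k. k \<in> S \<Longrightarrow> mv_polynomial (f k)"
  shows "mv_polynomial (\<lambda>x. \<Sum>k\<in>S. f k x)"
  using assms by (induction S rule: infinite_finite_induct) auto

lemma mv_polynomial_prod [intro]:
  assumes "\<And>k. k \<in> S \<Longrightarrow> mv_polynomial (f k)"
  shows "mv_polynomial (\<lambda>x. \<Prod>k\<in>S. f k x)"
  using assms by (induction S rule: infinite_finite_induct) auto

lemma mv_polynomial_holomorphic_line:
  assumes "mv_polynomial f"
  shows "(\<lambda>t. f (t *s a)) holomorphic_on S"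
proof -
  obtain A c where f: "finite A" "f = (\<lambda>x. \<Sum>I\<in>A. c I * mpow x I)"
    using assms by (auto simp: mv_polynomial_def)
  show ?thesis
    unfolding f mpow_def by (auto intro!: holomorphic_intros)
qed

lemma mv_polynomial_continuous:
  assumes "mv_polynomial f"
  shows "continuous_on UNIV f"
proof -
  obtain A c where f: "finite A" "f = (\<lambda>x. \<Sum>I\<in>A. c I * mpow x I)"
    using assms by (auto simp: mv_polynomial_def)
  show ?thesis
    unfolding f mpow_def by (auto intro!: continuous_intros)
qed

section \<open>Division-free Gaussian elimination\<close>

definition scaled_left_inverse ::
    "'i set \<Rightarrow> ('i \<Rightarrow> 'i \<Rightarrow> 'b \<Rightarrow> complex) \<Rightarrow> ('b \<Rightarrow> complex) \<Rightarrow> ('i \<Rightarrow> 'i \<Rightarrow> 'b \<Rightarrow> complex) \<Rightarrow> bool" where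
  "scaled_left_inverse S M p adj \<longleftrightarrow>
     (\<forall>x u r. (\<forall>i\<in>S. (\<Sum>j\<in>S. M i j x * u j) = r i) \<longrightarrow>
       (\<forall>i\<in>S. p x * u i = (\<Sum>j\<in>S. adj i j x * r j)))"

lemma scaled_left_inverseD:
  assumes "scaled_left_inverse S M p adj" "\<And>i. i \<in> S \<Longrightarrow> (\<Sum>j\<in>S. M i j x * u j) = r i" "i \<in> S"
  shows "p x * u i = (\<Sum>j\<in>S. adj i j x * r j)"
  using assms unfolding scaled_left_inverse_def by simp

text \<open>Rows are multiplied by the pivot and never divided, so all results stay in the class
  \<open>Rg\<close>. Diagonality at \<open>z\<close> is inherited by the reduced matrix, hence every
  pivot is nonzero at \<open>z\<close> and no row exchange occurs. The class is kept abstract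
  because it is used twice: for polynomials, and for functions continuous at 0.\<close>

lemma elimination:
  fixes Rg :: "('b \<Rightarrow> complex) \<Rightarrow> bool" and M :: "'i \<Rightarrow> 'i \<Rightarrow> 'b \<Rightarrow> complex"
  assumes minus: "\<And>f g. Rg f \<Longrightarrow> Rg g \<Longrightarrow> Rg (\<lambda>x. f x - g x)"
    and mult: "\<And>f g. Rg f \<Longrightarrow> Rg g \<Longrightarrow> Rg (\<lambda>x. f x * g x)"
    and one: "Rg (\<lambda>x. 1)"
    and "finite S"
    and "\<And>i j. i \<in> S \<Longrightarrow> j \<in> S \<Longrightarrow> Rg (M i j)"
    and "\<And>i. i \<in> S \<Longrightarrow> M i i z \<noteq> 0"
    and "\<And>i j. i \<in> S \<Longrightarrow> j \<in> S \<Longrightarrow> i \<noteq> j \<Longrightarrow> M i j z = 0"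
  shows "\<exists>p adj. Rg p \<and> p z \<noteq> 0 \<and> (\<forall>i\<in>S. \<forall>j\<in>S. Rg (adj i j)) \<and>
    scaled_left_inverse S M p adj"
  using assms(4-)
proof (induction S arbitrary: M rule: finite_induct)
  case empty
  then show ?case using one by (intro exI[of _ "\<lambda>x. 1"] exI[of _ "\<lambda>_ _ _. 0"]) (simp add:
    scaled_left_inverse_def)
next
  case (insert k S)
  have zero: "Rg (\<lambda>x. 0)" using minus[OF one one] by simp
  have uminus: "Rg (\<lambda>x. - f x)" if "Rg f" for f
    using minus[OF zero that] by simp
  have add: "Rg (\<lambda>x. f x + g x)" if "Rg f" "Rg g" for f g
    using minus[OF that(1) uminus[OF that(2)]] by simp
  have sum: "Rg (\<lambda>x. \<Sum>k\<in>T. f k x)" if "\<And>k. k \<in> T \<Longrightarrow> Rg (f k)" for T and f :: "'i \<Rightarrow> 'b \<Rightarrow> complex"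
    using that by (induction T rule: infinite_finite_induct) (auto intro: zero add)
  \<comment> \<open>Pivot times row \<open>i\<close> minus \<open>M i k\<close> times row
    \<open>k\<close>, which removes the unknown \<open>u k\<close>.\<close>
  define M' where "M' i j = (\<lambda>x. M k k x * M i j x - M i k x * M k j x)" for i j
  have "\<exists>p adj. Rg p \<and> p z \<noteq> 0 \<and> (\<forall>i\<in>S. \<forall>j\<in>S. Rg (adj i j)) \<and>
    scaled_left_inverse S M' p adj"
  proof (rule insert.IH)
    show "Rg (M' i j)" if "i \<in> S" "j \<in> S" for i j
      unfolding M'_def using that insert.prems(1) by (intro minus mult) auto
    show "M' i i z \<noteq> 0" if "i \<in> S" for i
    proof -
      have "i \<noteq> k" using that insert.hyps by auto
      then have "M i k z = 0" using that insert.prems(3)[of i k] by simp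
      then show ?thesis using that insert.prems(2)[of i] insert.prems(2)[of k] by (simp add: M'_def)
    qed
    show "M' i j z = 0" if "i \<in> S" "j \<in> S" "i \<noteq> j" for i j
    proof -
      have "i \<noteq> k" using that insert.hyps by auto
      then have "M i k z = 0" using that insert.prems(3)[of i k] by simp
      then show ?thesis using that insert.prems(3)[of i j] by (simp add: M'_def)
    qed
  qed
  then obtain p adj where p: "Rg p" "p z \<noteq> 0" and adj: "\<And>i j. i \<in> S \<Longrightarrow> j \<in> S \<Longrightarrow> Rg (adj i j)"
    and sol: "scaled_left_inverse S M' p adj"
    by blast
  \<comment> \<open>Obtained by back substitution: the reduced system has right-hand sides
    \<open>M k k x * r j - M j k x * r k\<close>, and row \<open>k\<close> then yields
    \<open>u k\<close>. The rows \<open>i \<noteq> k\<close> carry an extra factor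
    \<open>M k k x\<close>, so that all rows share the denominator
    \<open>M k k x * p x\<close>.\<close>
  define ad where "ad i j = (\<lambda>x.
      if i = k then (if j = k then p x + (\<Sum>l\<in>S. \<Sum>q\<in>S. M k l x * (adj l q x * M q k x))
                     else - (\<Sum>l\<in>S. M k l x * (adj l j x * M k k x)))
      else (if j = k then - (M k k x * (\<Sum>l\<in>S. adj i l x * M l k x)) else M k k x * (adj i j x * M k
        k x)))" for i j
  show ?case
  proof (intro exI[of _ "\<lambda>x. M k k x * p x"] exI[of _ ad] conjI ballI)
    show "Rg (\<lambda>x. M k k x * p x)" using p insert.prems(1) by (intro mult) auto
    show "M k k z * p z \<noteq> 0" using p insert.prems(2) by auto
    show "Rg (ad i j)" if "i \<in> insert k S" "j \<in> insert k S" for i j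
    proof -
      have M: "Rg (M i j)" if "i \<in> insert k S" "j \<in> insert k S" for i j
        using that insert.prems(1) by blast
      have 1: "Rg (\<lambda>x. p x + (\<Sum>l\<in>S. \<Sum>q\<in>S. M k l x * (adj l q x * M q k x)))"
        by (intro add mult sum adj M p) auto
      have 2: "Rg (\<lambda>x. - (\<Sum>l\<in>S. M k l x * (adj l j x * M k k x)))" if "j \<in> S"
        by (intro uminus mult sum adj M) (use that in auto)
      have 3: "Rg (\<lambda>x. - (M k k x * (\<Sum>l\<in>S. adj i l x * M l k x)))" if "i \<in> S"
        by (intro uminus mult sum adj M) (use that in auto)
      have 4: "Rg (\<lambda>x. M k k x * (adj i j x * M k k x))" if "i \<in> S" "j \<in> S"
        by (intro mult adj M) (use that in auto)
      show ?thesis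
        using that 1 2 3 4 by (cases "i = k"; cases "j = k") (simp_all add: ad_def)
    qed
  next
    show "scaled_left_inverse (insert k S) M (\<lambda>x. M k k x * p x) ad"
      unfolding scaled_left_inverse_def
    proof (intro allI impI ballI)
      fix x u r i
      assume eq: "\<forall>i\<in>insert k S. (\<Sum>j\<in>insert k S. M i j x * u j) = r i" and i: "i \<in> insert k S"
      have eqk: "M k k x * u k = r k - (\<Sum>j\<in>S. M k j x * u j)"
        using eq insert.hyps by (auto simp: algebra_simps)
      have eqi: "(\<Sum>j\<in>S. M' i j x * u j) = M k k x * r i - M i k x * r k" if "i \<in> S" for i
      proof -
        have "r i = M i k x * u k + (\<Sum>j\<in>S. M i j x * u j)"
          using eq that insert.hyps by simp
        then have "M k k x * r i = M i k x * (M k k x * u k) + M k k x * (\<Sum>j\<in>S. M i j x * u j)"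
          by (simp add: algebra_simps)
        also have "\<dots> = M i k x * r k + (M k k x * (\<Sum>j\<in>S. M i j x * u j) - M i k x * (\<Sum>j\<in>S. M k j x *
          u j))"
          unfolding eqk by (simp add: algebra_simps)
        also have "M k k x * (\<Sum>j\<in>S. M i j x * u j) - M i k x * (\<Sum>j\<in>S. M k j x * u j) =
          (\<Sum>j\<in>S. M' i j x * u j)"
          by (simp add: M'_def left_diff_distrib sum_distrib_left sum_subtractf mult.assoc)
        finally show ?thesis by simp
      qed
      have S: "p x * u i = (\<Sum>j\<in>S. adj i j x * M k k x * r j) - (\<Sum>j\<in>S. adj i j x * M j k x) * r k" if
        "i \<in> S" for i
      proof -
        have "p x * u i = (\<Sum>j\<in>S. adj i j x * (M k k x * r j - M j k x * r k))"
          using sol eqi that by (rule scaled_left_inverseD)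
        then show ?thesis
          by (simp add: right_diff_distrib sum_subtractf sum_distrib_right mult.assoc)
      qed
      show "M k k x * p x * u i = (\<Sum>j\<in>insert k S. ad i j x * r j)"
      proof (cases "i = k")
        case False
        then have "i \<in> S" using i by simp
        have "M k k x * p x * u i = M k k x * ((\<Sum>j\<in>S. adj i j x * M k k x * r j) - (\<Sum>j\<in>S. adj i j x
          * M j k x) * r k)"
          using S[OF \<open>i \<in> S\<close>] by (simp add: mult.assoc)
        also have "\<dots> = ad i k x * r k + (\<Sum>j\<in>S. M k k x * (adj i j x * M k k x) * r j)"
          using False by (simp add: ad_def right_diff_distrib sum_distrib_left mult.assoc)
        also have "(\<Sum>j\<in>S. M k k x * (adj i j x * M k k x) * r j) = (\<Sum>j\<in>S. ad i j x * r j)"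
          using False insert.hyps by (intro sum.cong) (auto simp: ad_def)
        finally show ?thesis using insert.hyps by simp
      next
        case True
        have "M k k x * p x * u k = p x * r k - (\<Sum>l\<in>S. M k l x * (p x * u l))"
        proof -
          have "M k k x * p x * u k = p x * (M k k x * u k)"
            by simp
          then show ?thesis
            unfolding eqk by (simp add: right_diff_distrib sum_distrib_left mult.left_commute)
        qed
        also have "(\<Sum>l\<in>S. M k l x * (p x * u l)) =
            (\<Sum>l\<in>S. \<Sum>j\<in>S. M k l x * (adj l j x * M k k x) * r j) - (\<Sum>l\<in>S. \<Sum>q\<in>S. M k l x * (adj l q x
              * M q k x)) * r k"
        proof -
          have "M k l x * (p x * u l) = (\<Sum>j\<in>S. M k l x * (adj l j x * M k k x) * r j) - (\<Sum>q\<in>S. M k l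
            x * (adj l q x * M q k x)) * r k"
            if "l \<in> S" for l
            unfolding S[OF that] by (simp add: right_diff_distrib sum_distrib_left sum_distrib_right
              mult.assoc)
          then show ?thesis
            by (simp add: sum_subtractf sum_distrib_right)
        qed
        also have "(\<Sum>l\<in>S. \<Sum>j\<in>S. M k l x * (adj l j x * M k k x) * r j) = - (\<Sum>j\<in>S. ad k j x * r j)"
        proof -
          have "(\<Sum>l\<in>S. \<Sum>j\<in>S. M k l x * (adj l j x * M k k x) * r j) =
            (\<Sum>j\<in>S. (\<Sum>l\<in>S. M k l x * (adj l j x * M k k x)) * r j)"
            by (subst sum.swap) (simp add: sum_distrib_right)
          also have "\<dots> = (\<Sum>j\<in>S. - (ad k j x * r j))"
            using insert.hyps by (intro sum.cong) (auto simp: ad_def)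
          finally show ?thesis by (simp add: sum_negf)
        qed
        finally show ?thesis
          using insert.hyps True by (simp add: ad_def algebra_simps)
      qed
    qed
  qed
qed

section \<open>Normal ordering of products of theta forms\<close>

fun operator_coeff :: "(('n::finite \<Rightarrow> nat) \<times> complex) list \<Rightarrow> complex ^ 'n \<Rightarrow> nat ^ 'n \<Rightarrow> nat ^ 'n \<Rightarrow>
    complex" where
  "operator_coeff [] x J L = (if L = 0 then 1 else 0)"
| "operator_coeff ((a, c) # ops) x J L =
     (\<Sum>i\<in>UNIV. of_nat (a i) * (x $ i * (if 0 < L $ i then operator_coeff ops x (J +
       axis i 1) (L - axis i 1) else 0)
        + of_nat (J $ i) * operator_coeff ops x J L)) + c * operator_coeff ops x J L"

lemma axis_diff_add: "0 < L $ i \<Longrightarrow> (L :: nat ^ 'n) - axis i 1 + axis i 1 = L"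
  by (auto simp: vec_eq_iff axis_def)

lemma msize_diff_axis: "0 < L $ i \<Longrightarrow> msize (L - axis i 1) + 1 = msize L"
  using msize_add[of "L - axis i 1" "axis i 1"] axis_diff_add[of L i] by simp

lemma operator_coeff_eq_0: "length ops < msize L \<Longrightarrow> operator_coeff ops x J L = 0"
proof (induction ops arbitrary: J L)
  case (Cons op ops)
  obtain a c where op: "op = (a, c)" by force
  have "operator_coeff ops x (J + axis i 1) (L - axis i 1) = 0" if "0 < L $ i" for i
    using Cons.prems msize_diff_axis[OF that] by (intro Cons.IH) simp
  moreover have "operator_coeff ops x J L = 0"
    using Cons.prems by (intro Cons.IH) simp
  ultimately show ?case by (simp add: op cong: if_cong)
qed auto

text \<open>Normal ordering: with D for differentiation, D^J of the composed operator is the sum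
  over \<open>L\<close> of \<open>operator_coeff ops x J L\<close> times D^(J+L). The head of the
  list acts last and reads the tail at \<open>J\<close> and at \<open>J + axis i 1\<close>, which is
  where the recursion of \<open>operator_coeff\<close> comes from.\<close>

lemma theta_forms_coeff_ec: "theta_forms_coeff ops x u J = (\<Sum>L | msize L \<le>
    length ops. operator_coeff ops x J L * u (J + L))"
proof (induction ops arbitrary: J)
  case Nil
  then show ?case by (simp add: msize_eq_0_iff)
next
  case (Cons op ops)
  obtain a c where op: "op = (a, c)" by force
  let ?S = "{L. msize L \<le> length (op # ops)}"
  have 1: "theta_forms_coeff ops x u J = (\<Sum>L\<in>?S. operator_coeff ops x J L * u (J + L))"
    unfolding Cons.IH by (intro sum.mono_neutral_left) (auto simp: operator_coeff_eq_0)
  have 2: "theta_forms_coeff ops x u (J + axis i 1) =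
      (\<Sum>L\<in>?S. (if 0 < L $ i then operator_coeff ops x (J + axis i 1) (L - axis i 1) else 0) * u (J +
        L))" for i
  proof -
    have "theta_forms_coeff ops x u (J + axis i 1) = (\<Sum>L | msize L \<le>
      length ops. operator_coeff ops x (J + axis i 1) L * u (J + axis i 1 + L))"
      by (rule Cons.IH)
    also have "\<dots> = (\<Sum>L\<in>{L\<in>?S. 0 < L $ i}. operator_coeff ops x (J +
      axis i 1) (L - axis i 1) * u (J + L))"
    proof (rule sum.reindex_bij_witness[where i = "\<lambda>L. L - axis i 1" and j = "\<lambda>L. L + axis i 1"])
      show "L - axis i 1 + axis i 1 = L" if "L \<in> {L \<in> ?S. 0 < L $ i}" for L
        using that by (intro axis_diff_add) auto
      show "L - axis i 1 \<in> {L. msize L \<le> length ops}" if "L \<in> {L \<in> ?S. 0 < L $ i}" for L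
        using that msize_diff_axis[of L i] by auto
      show "L + axis i 1 \<in> {L \<in> ?S. 0 < L $ i}" if "L \<in> {L. msize L \<le> length ops}" for L
        using that by (simp add: msize_add)
    qed (auto simp: add_ac)
    also have "\<dots> = (\<Sum>L\<in>?S. (if 0 < L $ i then operator_coeff ops x (J +
      axis i 1) (L - axis i 1) else 0) * u (J + L))"
      by (intro sum.mono_neutral_cong_left) auto
    finally show ?thesis .
  qed
  have "theta_forms_coeff (op # ops) x u J = (\<Sum>i\<in>UNIV. of_nat (a i) * (x $ i * theta_forms_coeff ops
    x u (J + axis i 1) + of_nat (J $ i) * theta_forms_coeff ops x u J)) +
      c * theta_forms_coeff ops x u J"
    by (simp add: op theta_form_coeff_def theta_coeff_def)
  also have "\<dots> = (\<Sum>i\<in>UNIV. \<Sum>L\<in>?S. of_nat (a i) * (x $ i * (if 0 < L $ i then operator_coeff ops x (J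
    + axis i 1) (L - axis i 1) else 0)
        + of_nat (J $ i) * operator_coeff ops x J L) * u (J + L)) +
          (\<Sum>L\<in>?S. c * operator_coeff ops x J L * u (J + L))"
    unfolding 1 2 by (simp only: sum_distrib_left sum.distrib[symmetric] distrib_right distrib_left
      mult.assoc)
  also have "\<dots> = (\<Sum>L\<in>?S. operator_coeff (op # ops) x J L * u (J + L))"
    by (subst sum.swap) (simp only: op operator_coeff.simps sum_distrib_right sum.distrib[symmetric]
      distrib_right)
  finally show ?case .
qed

text \<open>Differentiating an equation does not change its principal part, which is why finitely many
  eliminations suffice.\<close>
lemma operator_coeff_top: "msize L = length ops \<Longrightarrow> operator_coeff ops x J L =
    operator_coeff ops x J' L"
proof (induction ops arbitrary: J J' L)
  case (Cons op ops)
  obtain a c where op: "op = (a, c)" by force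
  have "operator_coeff ops x (J + axis i 1) (L - axis i 1) = operator_coeff ops x (J' +
    axis i 1) (L - axis i 1)" if "0 < L $ i" for i
    using Cons.prems msize_diff_axis[OF that] by (intro Cons.IH) simp
  moreover have "operator_coeff ops x J L = 0" "operator_coeff ops x J' L = 0"
    using Cons.prems by (auto intro: operator_coeff_eq_0)
  ultimately show ?case by (simp add: op cong: if_cong)
qed auto

text \<open>Every shift comes with a factor \<open>x $ i\<close>; at the origin the theta forms act
  diagonally.\<close>

lemma operator_coeff_at_0: "L \<noteq> 0 \<Longrightarrow> operator_coeff ops 0 J L = 0"
  by (induction ops arbitrary: J L) auto

lemma operator_coeff_polynomial: "mv_polynomial (\<lambda>x. operator_coeff ops x J L)"
proof (induction ops arbitrary: J L)
  case (Cons op ops)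
  obtain a c where op: "op = (a, c)" by force
  have "mv_polynomial (\<lambda>x. if 0 < L $ i then operator_coeff ops x (J +
    axis i 1) (L - axis i 1) else 0)" for i
    using Cons.IH by (cases "0 < L $ i") auto
  then show ?case
    unfolding op operator_coeff.simps by (intro mv_polynomial_add mv_polynomial_mult
      mv_polynomial_sum
      mv_polynomial_const mv_polynomial_coord Cons.IH)
qed auto

text \<open>Each factor of the product either raises the order by one or contributes a multiplier at
  most linear in \<open>msize J\<close>. A term that reaches \<open>L\<close> therefore contains at
  most \<open>length ops - msize L\<close> such multipliers.\<close>

lemma operator_coeff_bound:
  "\<exists>C\<ge>0. \<forall>J L. msize L \<le> length ops \<longrightarrow>
     norm (operator_coeff ops x J L) \<le> C * real (msize J + 1) ^ (length ops - msize L)"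
proof (induction ops)
  case Nil
  then show ?case by (intro exI[of _ 1]) auto
next
  case (Cons op ops)
  obtain a c where op: "op = (a, c)" by force
  obtain C where C: "C \<ge> 0" "\<And>J L. msize L \<le> length ops \<Longrightarrow>
     norm (operator_coeff ops x J L) \<le> C * real (msize J + 1) ^ (length ops - msize L)"
    using Cons.IH by auto
  let ?d = "length (op # ops)"
  \<comment> \<open>The power of two pays for replacing \<open>msize (J + axis i 1) + 1\<close> by
    twice \<open>msize J + 1\<close>.\<close>
  define C' where "C' = (\<Sum>i\<in>UNIV. real (a i) * (norm (x $ i) * (C * 2 ^ ?d) + C)) + norm c * C"
  have "C' \<ge> 0"
    unfolding C'_def using C(1) by (intro add_nonneg_nonneg sum_nonneg mult_nonneg_nonneg) auto
  moreover have "norm (operator_coeff (op # ops) x J L) \<le> C' * real (msize J + 1) ^ (?d - msize L)"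
    if L: "msize L \<le> ?d" for J L
  proof -
    let ?X = "real (msize J + 1) ^ (?d - msize L)"
    have X0: "?X \<ge> 0" by simp
    have b1: "norm (if 0 < L $ i then operator_coeff ops x (J + axis i 1) (L - axis i 1) else 0) \<le>
      C * 2 ^ ?d * ?X" for i
    proof (cases "0 < L $ i")
      case True
      note s = msize_diff_axis[OF True]
      have "norm (operator_coeff ops x (J + axis i 1) (L - axis i 1)) \<le>
          C * real (msize (J + axis i 1) + 1) ^ (length ops - msize (L - axis i 1))"
        using s L by (intro C) auto
      also have "length ops - msize (L - axis i 1) = ?d - msize L"
        using s by auto
      also have "real (msize (J + axis i 1) + 1) ^ (?d - msize L) \<le> (2 * real (msize J +
        1)) ^ (?d - msize L)"
        by (intro power_mono) (auto simp: msize_add)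
      also have "(2 * real (msize J + 1)) ^ (?d - msize L) = 2 ^ (?d - msize L) * ?X"
        by (rule power_mult_distrib)
      also have "\<dots> \<le> 2 ^ ?d * ?X"
        by (intro mult_right_mono power_increasing) auto
      finally show ?thesis
        using True C(1) by (simp add: mult_left_mono mult.assoc)
    next
      case False
      then show ?thesis using C(1) X0 by simp
    qed
    have b2: "real k * norm (operator_coeff ops x J L) \<le> C * ?X" if "k \<le> msize J + 1" for k
    proof (cases "msize L \<le> length ops")
      case True
      have "real k * norm (operator_coeff ops x J L) \<le> real (msize J + 1) * (C * real (msize J +
        1) ^ (length ops - msize L))"
        using that C(1) True by (intro mult_mono C(2)) auto
      also have "?d - msize L = Suc (length ops - msize L)"
        using True by simp
      then have "real (msize J + 1) * (C * real (msize J + 1) ^ (length ops - msize L)) = C * ?X"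
        by (simp del: of_nat_add)
      finally show ?thesis .
    next
      case False
      then show ?thesis using C(1) X0 by (simp add: operator_coeff_eq_0)
    qed
    have "norm (operator_coeff (op # ops) x J L) \<le>
      (\<Sum>i\<in>UNIV. real (a i) * (norm (x $ i) * norm (if 0 < L $ i then operator_coeff ops x (J +
        axis i 1) (L - axis i 1) else 0)
        + real (J $ i) * norm (operator_coeff ops x J L))) +
          norm c * norm (operator_coeff ops x J L)"
      unfolding op operator_coeff.simps
      by (intro order_trans[OF norm_triangle_ineq] add_mono order_trans[OF norm_sum] sum_mono)
         (auto simp: norm_mult intro!: mult_left_mono order_trans[OF norm_triangle_ineq])
    also have "\<dots> \<le> (\<Sum>i\<in>UNIV. real (a i) * (norm (x $ i) * (C * 2 ^ ?d * ?X) + C * ?X)) +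
      norm c * (C * ?X)"
    proof (intro add_mono sum_mono mult_left_mono)
      show "real (J $ i) * norm (operator_coeff ops x J L) \<le> C * ?X" for i
        using msize_nth_le[of J i] by (intro b2) simp
      show "norm (operator_coeff ops x J L) \<le> C * ?X"
        using b2[of 1] by simp
    qed (use b1 in auto)
    also have "\<dots> = C' * ?X"
      unfolding C'_def distrib_right sum_distrib_right by (simp only: distrib_left distrib_right
        mult_ac)
    finally show ?thesis .
  qed
  ultimately show ?case by blast
qed

text \<open>The multinomial coefficient |K|!/K! is at most n^|K|. Bounds by |K|!, natural for a
  recursion on size, thus turn into the bounds of \<open>convergent_coeffs\<close>.\<close>

lemma fact_le_vfact: "fact (msize K) \<le> real (CARD('n)) ^ msize K * vfact (K :: nat ^ 'n::finite)"
proof (induction "msize K" arbitrary: K)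
  case 0
  then show ?case by (simp add: msize_eq_0_iff)
next
  case (Suc k)
  let ?n = "real (CARD('n))"
  have b: "real (K $ j) * fact k \<le> ?n ^ k * vfact K" for j
  proof (cases "0 < K $ j")
    case True
    have k: "k = msize (K - axis j 1)"
      using msize_diff_axis[OF True] Suc(2) by simp
    have "real (K $ j) * fact k \<le> real (K $ j) * (?n ^ k * vfact (K - axis j 1))"
      using Suc(1)[OF k] by (intro mult_left_mono) (simp_all add: k)
    also have "\<dots> = ?n ^ k * vfact K"
      using vfact_add_axis[of "K - axis j 1" j] axis_diff_add[OF True] True
      by (simp add: axis_def)
    finally show ?thesis .
  qed simp
  have "fact (msize K) = real (msize K) * fact k"
    using Suc(2)[symmetric] by simp
  also have "\<dots> = (\<Sum>j\<in>UNIV. real (K $ j) * fact k)"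
    by (simp add: msize_def sum_distrib_right)
  also have "\<dots> \<le> (\<Sum>j\<in>(UNIV :: 'n set). ?n ^ k * vfact K)"
    by (intro sum_mono b)
  also have "\<dots> = ?n ^ msize K * vfact K"
    using Suc(2)[symmetric] by simp
  finally show ?case .
qed

text \<open>The factorials with arguments \<open>n + m\<close> and \<open>n + l\<close> differ by
  \<open>m - l\<close> factors, each at least \<open>n + 1\<close>. This absorbs the growth found in
  \<open>operator_coeff_bound\<close>.\<close>

lemma power_mult_fact_le:
  assumes "l \<le> m"
  shows "(n + 1) ^ (m - l) * fact (n + l) \<le> (fact (n + m) :: nat)"
  using assms
proof (induction "m - l" arbitrary: m)
  case (Suc k)
  define m' where "m' = m - 1"
  have m: "m = Suc m'" "l \<le> m'" "k = m' - l"
    using Suc(2) by (auto simp: m'_def)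
  have "(n + 1) ^ (m - l) * fact (n + l) = (n + 1) * ((n + 1) ^ (m' - l) * fact (n + l))"
    using m by (simp add: Suc_diff_le algebra_simps)
  also have "\<dots> \<le> (n + m) * fact (n + m')"
    using m Suc(1)[of m'] by (intro mult_mono) auto
  also have "\<dots> = fact (n + m)"
    using m by simp
  finally show ?case .
qed auto

lemma multiindex_split:
  assumes "N \<le> msize K"
  obtains K1 S where "K = K1 + S" "msize K1 = N"
proof -
  have "\<exists>K1 S. K = K1 + S \<and> msize K1 = N" if "N \<le> msize K"
    using that
  proof (induction "msize K - N" arbitrary: N)
    case 0
    then show ?case by (intro exI[of _ K] exI[of _ 0]) auto
  next
    case (Suc d)
    then have "d = msize K - Suc N" "Suc N \<le> msize K"
      by auto
    from Suc(1)[OF this] obtain K1 S where K1: "K = K1 + S" "msize K1 = Suc N"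
      by blast
    then obtain j where "K1 $ j \<noteq> 0"
      unfolding msize_def by (metis nat.distinct(1) sum.neutral)
    then have "0 < K1 $ j" by simp
    from axis_diff_add[OF this] msize_diff_axis[OF this] K1 show ?case
      by (intro exI[of _ "K1 - axis j 1"] exI[of _ "axis j 1 +
        S"]) (auto simp: add.assoc[symmetric])
  qed
  with assms that show ?thesis by blast
qed

section \<open>Reduction to derivatives in the box\<close>

lemma mem_index_box: "m > 0 \<Longrightarrow> I \<in> index_box m \<longleftrightarrow> (\<forall>j. I $ j < m)"
  by (cases m) (auto simp: index_box_def less_Suc_eq_le)

lemma finite_index_box [simp]: "finite (index_box m)"
  unfolding index_box_def by (rule finite_bounded_index)

locale mellin_data =
  fixes m :: nat and mm :: "'n::finite \<Rightarrow> nat"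
  assumes mm_less: "mm j < m" and mm_pos: "0 < mm j"
begin

lemma m_pos: "m > 0"
  using mm_less[of undefined] by linarith

definition kappa :: "'n \<Rightarrow> complex" where
  "kappa j = (- 1) ^ mm j * of_nat m ^ m"

lemma kappa_nonzero [simp]: "kappa j \<noteq> 0"
  using m_pos by (simp add: kappa_def)

lemma length_mops: "length (mellin_factors m mm j) = m"
  using mm_less[of j] by (simp add: mellin_factors_def)

definition mellin_coeff :: "'n \<Rightarrow> complex ^ 'n \<Rightarrow> nat ^ 'n \<Rightarrow> nat ^ 'n \<Rightarrow> complex" where
  "mellin_coeff j x J L = operator_coeff (mellin_factors m mm j) x J L - (if L =
    axis j m then kappa j else 0)"

lemma mellin_equation_iff_co:
  "mellin_equation m mm x u j J \<longleftrightarrow> (\<Sum>L | msize L \<le> m. mellin_coeff j x J L * u (J + L)) = 0"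
proof -
  have "(\<Sum>L | msize L \<le> m. (if L = axis j m then kappa j else 0) * u (J + L)) = kappa j * u (J +
    axis j m)"
    by (subst sum.remove[of _ "axis j m"]) auto
  then show ?thesis
    by (simp add: mellin_equation_def theta_forms_coeff_ec length_mops mellin_coeff_def
      left_diff_distrib sum_subtractf kappa_def)
qed

lemma mellin_coeff_top: "msize L = m \<Longrightarrow> mellin_coeff j x J L = mellin_coeff j x J' L"
  unfolding mellin_coeff_def using operator_coeff_top[of L "mellin_factors m mm j" x J J'] by (simp
    add: length_mops)

lemma mellin_coeff_polynomial: "mv_polynomial (\<lambda>x. mellin_coeff j x J L)"
  unfolding mellin_coeff_def by (intro mv_polynomial_minus operator_coeff_polynomial
    mv_polynomial_const)

text \<open>An index may leave the box in several directions and so be the leading derivative of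
  several equations. Choosing one direction makes the linear systems square; that all equations hold
  in the end is the content of \<open>reduction_coeff_meq\<close>.\<close>

definition large_dir :: "nat ^ 'n \<Rightarrow> 'n" where
  "large_dir K = (SOME j. m \<le> K $ j)"

definition large_base :: "nat ^ 'n \<Rightarrow> nat ^ 'n" where
  "large_base K = K - axis (large_dir K) m"

lemma large_base_add:
  assumes "K \<notin> index_box m"
  shows "large_base K + axis (large_dir K) m = K"
proof -
  have "\<exists>j. m \<le> K $ j"
    using assms m_pos by (auto simp: mem_index_box not_less)
  then have "m \<le> K $ large_dir K"
    unfolding large_dir_def by (rule someI_ex)
  then show ?thesis
    by (auto simp: large_base_def vec_eq_iff axis_def)
qed

lemma msize_base:
  assumes "K \<notin> index_box m"
  shows "msize (large_base K) + m = msize K"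
  using arg_cong[OF large_base_add[OF assms], of msize] by (simp add: msize_add)

section \<open>Linear systems for the derivatives of a fixed size\<close>

definition outside_level :: "nat \<Rightarrow> (nat ^ 'n) set" where
  "outside_level N = {K. msize K = N \<and> K \<notin> index_box m}"

definition box_level :: "nat \<Rightarrow> (nat ^ 'n) set" where
  "box_level N = {K. msize K = N \<and> K \<in> index_box m}"

lemma finite_NB [simp]: "finite (outside_level N)" and finite_BX [simp]: "finite (box_level N)"
  by (rule finite_subset[OF _ finite_msize_le[of N]], simp add: outside_level_def box_level_def
    subset_iff)+

text \<open>Row \<open>K\<close> is the top-order part of the equation chosen for \<open>K\<close>;
  columns run over all indices of the same size, inside and outside the box. The guard excludes
  truncated subtraction, which would name a wrong derivative.\<close>

definition principal_matrix :: "nat ^ 'n \<Rightarrow> nat ^ 'n \<Rightarrow> complex ^ 'n \<Rightarrow> complex" where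
  "principal_matrix K K' x = (if \<forall>i. large_base K $ i \<le>
    K' $ i then mellin_coeff (large_dir K) x (large_base K) (K' - large_base K) else 0)"

lemma principal_matrix_polynomial: "mv_polynomial (principal_matrix K K')"
proof (cases "\<forall>i. large_base K $ i \<le> K' $ i")
  case True
  then show ?thesis
    using mellin_coeff_polynomial by (simp add: principal_matrix_def[abs_def])
next
  case False
  then have "principal_matrix K K' = (\<lambda>x. 0)"
    by (simp add: principal_matrix_def[abs_def] del: not_all)
  then show ?thesis
    by (simp add: mv_polynomial_const)
qed

text \<open>At 0 the theta side keeps only its term of order 0, so the entry is
  \<open>- kappa (large_dir K)\<close>, contributed by the m-th partial derivative.\<close>

lemma principal_matrix_diag:
  assumes "K \<notin> index_box m"
  shows "principal_matrix K K 0 \<noteq> 0"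
proof -
  have le: "large_base K $ i \<le> K $ i" for i
    by (simp add: large_base_def)
  have "K - large_base K = (large_base K + axis (large_dir K) m) - large_base K"
    using large_base_add[OF assms] by simp
  also have "\<dots> = axis (large_dir K) m"
    by simp
  finally have "K - large_base K = axis (large_dir K) m" .
  moreover have "axis (large_dir K) m \<noteq> (0 :: nat ^ 'n)"
    using m_pos by (simp add: axis_eq_0_iff)
  ultimately show ?thesis
    using le by (simp add: principal_matrix_def mellin_coeff_def operator_coeff_at_0)
qed

lemma principal_matrix_off_diag:
  assumes "K \<notin> index_box m" "msize K' = msize K" "K' \<noteq> K"
  shows "principal_matrix K K' 0 = 0"
proof (cases "\<forall>i. large_base K $ i \<le> K' $ i")
  case True
  then have K': "large_base K + (K' - large_base K) = K'"
    by (simp add: vec_eq_iff)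
  have "K' - large_base K \<noteq> axis (large_dir K) m"
  proof
    assume "K' - large_base K = axis (large_dir K) m"
    with K' large_base_add[OF assms(1)] assms(3) show False by simp
  qed
  moreover have "K' - large_base K \<noteq> 0"
  proof
    assume "K' - large_base K = 0"
    with K' have "msize K' = msize (large_base K)" by simp
    with assms(2) msize_base[OF assms(1)] m_pos show False by simp
  qed
  ultimately show ?thesis
    by (simp add: principal_matrix_def mellin_coeff_def operator_coeff_at_0)
qed (auto simp: principal_matrix_def)

lemma finite_msize_less [simp]: "finite {L :: nat ^ 'n. msize L < N}"
  by (rule finite_subset[OF _ finite_msize_le[of N]]) auto

definition lower_part :: "complex ^ 'n \<Rightarrow> nat \<Rightarrow> nat ^ 'n \<Rightarrow> nat ^ 'n \<Rightarrow> (nat ^ 'n \<Rightarrow> complex) \<Rightarrow> complex"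
    where
  "lower_part x N K S u = - ((\<Sum>K'\<in>box_level N. principal_matrix K K' x * u (K' + S)) +
     (\<Sum>L | msize L < m. mellin_coeff (large_dir K) x (large_base K + S) L * u (large_base K + S +
       L)))"

text \<open>Adding \<open>large_base K\<close> turns the terms of order m into a row over the
  indices of size \<open>N\<close>. By \<open>mellin_coeff_top\<close> the base
  \<open>large_base K + S\<close> may be replaced by \<open>large_base K\<close> there, so the
  matrix does not see \<open>S\<close>; only \<open>lower_part\<close> does.\<close>

lemma equation_split:
  assumes K: "K \<in> outside_level N" and eq: "mellin_equation m mm x u (large_dir K) (large_base K +
    S)"
  shows "(\<Sum>K'\<in>outside_level N. principal_matrix K K' x * u (K' + S)) = lower_part x N K S u"
proof -
  let ?J = "large_base K" and ?j = "large_dir K"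
  have K': "msize K = N" "K \<notin> index_box m"
    using K by (auto simp: outside_level_def)
  have fin: "finite {L :: nat ^ 'n. msize L = n}" for n
    by (rule finite_subset[OF _ finite_msize_le[of n]]) auto
  have "0 = (\<Sum>L\<in>{L. msize L = m} \<union> {L. msize L < m}. mellin_coeff ?j x (?J + S) L * u (?J + S + L))"
    using eq unfolding mellin_equation_iff_co by (subst eq_commute) (erule trans[rotated], rule
      sum.cong, auto)
  also have "\<dots> = (\<Sum>L | msize L = m. mellin_coeff ?j x (?J + S) L * u (?J + S + L)) +
      (\<Sum>L | msize L < m. mellin_coeff ?j x (?J + S) L * u (?J + S + L))"
    by (rule sum.union_disjoint) (auto simp: fin)
  also have "(\<Sum>L | msize L = m. mellin_coeff ?j x (?J + S) L * u (?J + S + L)) =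
      (\<Sum>K'\<in>{K'. msize K' = N \<and> (\<forall>i. ?J $ i \<le> K' $ i)}. mellin_coeff ?j x ?J (K' - ?J) * u (K' + S))"
  proof (rule sum.reindex_bij_witness[where i = "\<lambda>K'. K' - ?J" and j = "\<lambda>L. ?J + L"])
    fix L :: "nat ^ 'n" assume L: "L \<in> {L. msize L = m}"
    show "?J + L \<in> {K'. msize K' = N \<and> (\<forall>i. ?J $ i \<le> K' $ i)}"
      using L msize_base[OF K'(2)] K'(1) by (auto simp: msize_add)
    show "mellin_coeff ?j x ?J (?J + L - ?J) * u (?J + L + S) = mellin_coeff ?j x (?J +
      S) L * u (?J + S + L)"
      using L mellin_coeff_top[of L ?j x ?J "?J + S"] by (simp add: add_ac)
  next
    fix K' :: "nat ^ 'n" assume K'': "K' \<in> {K'. msize K' = N \<and> (\<forall>i. ?J $ i \<le> K' $ i)}"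
    show *: "?J + (K' - ?J) = K'"
      using K'' by (simp add: vec_eq_iff)
    have "msize ?J + msize (K' - ?J) = N"
      using arg_cong[OF *, of msize] K'' by (simp add: msize_add)
    then show "K' - ?J \<in> {L. msize L = m}"
      using msize_base[OF K'(2)] K'(1) by simp
  qed simp
  also have "\<dots> = (\<Sum>K' | msize K' = N. principal_matrix K K' x * u (K' + S))"
    by (rule sum.mono_neutral_cong_left) (auto simp: fin principal_matrix_def)
  also have "{K'. msize K' = N} = outside_level N \<union> box_level N"
    by (auto simp: outside_level_def box_level_def)
  also have "(\<Sum>K'\<in>outside_level N \<union> box_level N. principal_matrix K K' x * u (K' + S)) =
     (\<Sum>K'\<in>outside_level N. principal_matrix K K' x * u (K' + S)) +
       (\<Sum>K'\<in>box_level N. principal_matrix K K' x * u (K' + S))"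
    by (rule sum.union_disjoint) (simp, simp, auto simp: outside_level_def box_level_def)
  finally show ?thesis
    by (simp add: lower_part_def algebra_simps eq_neg_iff_add_eq_0)
qed

lemma ex_elimination:
  "\<exists>p adj. mv_polynomial p \<and> p 0 \<noteq> 0 \<and>
    (\<forall>K\<in>outside_level N. \<forall>K'\<in>outside_level N. mv_polynomial (adj K K')) \<and>
     scaled_left_inverse (outside_level N) principal_matrix p adj"
proof (rule elimination)
  show "principal_matrix K K 0 \<noteq> 0" if "K \<in> outside_level N" for K
    using that by (auto simp: outside_level_def principal_matrix_diag)
  show "principal_matrix K K' 0 = 0" if "K \<in> outside_level N" "K' \<in> outside_level N" "K \<noteq> K'" for K
    K'
    using that by (intro principal_matrix_off_diag) (auto simp: outside_level_def)
qed (simp_all add: mv_polynomial_minus mv_polynomial_mult mv_polynomial_const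
    principal_matrix_polynomial)

definition level_denominator :: "nat \<Rightarrow> complex ^ 'n \<Rightarrow> complex" where
  "level_denominator N = (SOME p. \<exists>adj. mv_polynomial p \<and> p 0 \<noteq> 0 \<and>
    (\<forall>K\<in>outside_level N. \<forall>K'\<in>outside_level N. mv_polynomial (adj K K')) \<and>
     scaled_left_inverse (outside_level N) principal_matrix p adj)"

definition level_adjugate :: "nat \<Rightarrow> nat ^ 'n \<Rightarrow> nat ^ 'n \<Rightarrow> complex ^ 'n \<Rightarrow> complex" where
  "level_adjugate N = (SOME adj. mv_polynomial (level_denominator N) \<and> level_denominator N 0 \<noteq> 0 \<and>
    (\<forall>K\<in>outside_level N. \<forall>K'\<in>outside_level N. mv_polynomial (adj K K')) \<and>
     scaled_left_inverse (outside_level N) principal_matrix (level_denominator N) adj)"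

lemma level_elimination: "mv_polynomial (level_denominator N) \<and> level_denominator N 0 \<noteq> 0 \<and>
    (\<forall>K\<in>outside_level N. \<forall>K'\<in>outside_level N. mv_polynomial (level_adjugate N K K')) \<and>
     scaled_left_inverse (outside_level N) principal_matrix (level_denominator N) (level_adjugate
       N)"
proof -
  have "\<exists>adj. mv_polynomial (level_denominator N) \<and> level_denominator N 0 \<noteq> 0 \<and>
    (\<forall>K\<in>outside_level N. \<forall>K'\<in>outside_level N. mv_polynomial (adj K K')) \<and>
     scaled_left_inverse (outside_level N) principal_matrix (level_denominator N) adj"
    unfolding level_denominator_def by (rule someI_ex[OF ex_elimination])
  then show ?thesis
    unfolding level_adjugate_def by (rule someI_ex)
qed

text \<open>Box entries are below m, so every box index is smaller than this size. From here on no
  derivative is free, and the matrix rows have no box columns.\<close>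

definition top_level :: nat where "top_level = CARD('n) * m"

definition discriminant :: "complex ^ 'n \<Rightarrow> complex" where
  "discriminant x = (\<Prod>N\<le>top_level. level_denominator N x)"

lemma discriminant_polynomial: "mv_polynomial discriminant"
  unfolding discriminant_def[abs_def] using level_elimination by (intro mv_polynomial_prod) auto

lemma discriminant_0: "discriminant 0 \<noteq> 0"
  unfolding discriminant_def using level_elimination by simp

lemma discriminant_pN: "discriminant x \<noteq> 0 \<Longrightarrow> N \<le> top_level \<Longrightarrow> level_denominator N x \<noteq> 0"
  unfolding discriminant_def by auto

lemma large_not_in_box:
  fixes K :: "nat ^ 'n"
  assumes "top_level \<le> msize K"
  shows "K \<notin> index_box m"
proof
  assume "K \<in> index_box m"
  then have "K $ j < m" for j
    by (simp add: mem_index_box m_pos)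
  then have "msize K < (\<Sum>j\<in>(UNIV :: 'n set). m)"
    unfolding msize_def by (intro sum_strict_mono) auto
  with assms show False by (simp add: top_level_def)
qed

lemma box_level_N1: "box_level top_level = {}"
  using large_not_in_box by (force simp: box_level_def)

section \<open>One reduction step and its well-foundedness\<close>

definition elimination_step :: "nat \<Rightarrow> nat ^ 'n \<Rightarrow> nat ^ 'n \<Rightarrow> complex ^ 'n \<Rightarrow> (nat ^ 'n \<Rightarrow> complex) \<Rightarrow>
    complex" where
  "elimination_step N K S x u = (\<Sum>K2\<in>outside_level N. level_adjugate N K K2 x * lower_part x N K2 S
    u)"

lemma level_solve:
  assumes "K \<in> outside_level N" and "\<And>K2. K2 \<in> outside_level N \<Longrightarrow>
    mellin_equation m mm x u (large_dir K2) (large_base K2 + S)"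
  shows "level_denominator N x * u (K + S) = elimination_step N K S x u"
proof -
  have "scaled_left_inverse (outside_level N) principal_matrix (level_denominator N) (level_adjugate
    N)"
    using level_elimination by blast
  from scaled_left_inverseD[OF this, of x "\<lambda>K. u (K + S)" "\<lambda>K2. lower_part x N K2 S u" K]
  show ?thesis
    using assms equation_split unfolding elimination_step_def by blast
qed

lemma lower_part_add: "lower_part x N K S (\<lambda>J. u J + v J) = lower_part x N K S u +
    lower_part x N K S v"
  by (simp add: lower_part_def distrib_left sum.distrib)

lemma lower_part_scale: "lower_part x N K S (\<lambda>J. u J * c) = lower_part x N K S u * c"
  by (simp add: lower_part_def sum_distrib_right distrib_right mult.assoc flip: minus_add_distrib)

lemma elimination_step_add: "elimination_step N K S x (\<lambda>J. u J + v J) = elimination_step N K S x u +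
    elimination_step N K S x v"
  by (simp add: elimination_step_def lower_part_add distrib_left sum.distrib)

lemma elimination_step_scale: "elimination_step N K S x (\<lambda>J. u J * c) =
    elimination_step N K S x u * c"
  by (simp add: elimination_step_def lower_part_scale sum_distrib_right mult.assoc)

lemma elimination_step_sum: "elimination_step N K S x (\<lambda>J. \<Sum>I\<in>B. w J I * c I) =
    (\<Sum>I\<in>B. elimination_step N K S x (\<lambda>J. w J I) * c I)"
proof (induction B rule: infinite_finite_induct)
  case (insert I B)
  then show ?case by (simp add: elimination_step_add elimination_step_scale)
qed (simp_all add: elimination_step_def lower_part_def)

text \<open>Justifies recursion on size. Box columns stay in the box, being unshifted or absent, and
  the remaining entries are smaller than \<open>K + S\<close> because their order
  \<open>msize L\<close> is below m.\<close>

lemma elimination_step_cong: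
  assumes "\<And>J. J \<in> index_box m \<or> msize J < msize (K + S) \<Longrightarrow> u J = v J"
    and "K \<in> outside_level N" "S = 0 \<or> box_level N = {}"
  shows "elimination_step N K S x u = elimination_step N K S x v"
proof -
  have "lower_part x N K2 S u = lower_part x N K2 S v" if "K2 \<in> outside_level N" for K2
  proof -
    have "(\<Sum>K'\<in>box_level N. principal_matrix K2 K' x * u (K' + S)) =
      (\<Sum>K'\<in>box_level N. principal_matrix K2 K' x * v (K' + S))"
      using assms(1,3) by (intro sum.cong refl) (auto simp: box_level_def)
    moreover have "u (large_base K2 + S + L) = v (large_base K2 + S + L)" if "msize L < m" for L
      using that \<open>K2 \<in> outside_level N\<close> assms(2) msize_base[of K2]
      by (intro assms(1)) (auto simp: outside_level_def msize_add)
    ultimately show ?thesis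
      unfolding lower_part_def by simp
  qed
  then show ?thesis
    unfolding elimination_step_def by (intro sum.cong refl) simp
qed

text \<open>Below \<open>top_level\<close> an index is treated at its own size without a shift,
  since a shift could push box columns out of the box. From \<open>top_level\<close> on there are no
  box columns, and the single system of that size serves for all larger indices.\<close>

lemma level_cases:
  assumes "K \<notin> index_box m"
  obtains N K1 S where "K = K1 + S" "K1 \<in> outside_level N" "N \<le> top_level" "S = 0 \<or> box_level N =
    {}" "top_level \<le> msize K \<Longrightarrow> N = top_level"
proof (cases "msize K < top_level")
  case True
  show ?thesis
    by (rule that[of K 0 "msize K"]) (use True assms in \<open>auto simp: outside_level_def\<close>)
next
  case False
  then obtain K1 S where "K = K1 + S" "msize K1 = top_level"
    using multiindex_split[of top_level K] by auto
  then show ?thesis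
    using large_not_in_box[of K1] box_level_N1 by (intro that[of K1 S top_level]) (auto simp:
      outside_level_def)
qed

section \<open>Universal coefficients, holomorphic along lines through the origin\<close>

definition holomorphic_on_lines :: "(complex ^ 'n \<Rightarrow> complex) \<Rightarrow> bool" where
  "holomorphic_on_lines g \<longleftrightarrow> (\<forall>a. (\<lambda>t. g (t *s a)) holomorphic_on {t. discriminant (t *s a) \<noteq> 0})"

lemma holomorphic_on_lines_polynomial: "mv_polynomial g \<Longrightarrow> holomorphic_on_lines g"
  unfolding holomorphic_on_lines_def by (simp add: mv_polynomial_holomorphic_line)

lemma holomorphic_on_lines_add: "holomorphic_on_lines f \<Longrightarrow> holomorphic_on_lines g \<Longrightarrow>
    holomorphic_on_lines (\<lambda>x. f x + g x)"
  unfolding holomorphic_on_lines_def by (auto intro: holomorphic_intros)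

lemma holomorphic_on_lines_uminus: "holomorphic_on_lines f \<Longrightarrow> holomorphic_on_lines (\<lambda>x. - f x)"
  unfolding holomorphic_on_lines_def by (auto intro: holomorphic_intros)

lemma holomorphic_on_lines_mult: "holomorphic_on_lines f \<Longrightarrow> holomorphic_on_lines g \<Longrightarrow>
    holomorphic_on_lines (\<lambda>x. f x * g x)"
  unfolding holomorphic_on_lines_def by (auto intro: holomorphic_intros)

lemma holomorphic_on_lines_sum: "(\<And>k. k \<in> S \<Longrightarrow> holomorphic_on_lines (f k)) \<Longrightarrow>
    holomorphic_on_lines (\<lambda>x. \<Sum>k\<in>S. f k x)"
  unfolding holomorphic_on_lines_def by (auto intro: holomorphic_intros)

lemma holomorphic_on_lines_divide: "holomorphic_on_lines f \<Longrightarrow> holomorphic_on_lines g \<Longrightarrow>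
    (\<And>x. discriminant x \<noteq> 0 \<Longrightarrow> g x \<noteq> 0) \<Longrightarrow> holomorphic_on_lines (\<lambda>x. f x / g x)"
  unfolding holomorphic_on_lines_def by (auto intro: holomorphic_intros)

lemma holomorphic_on_lines_step:
  assumes "K \<in> outside_level N" "\<And>J. J \<in> index_box m \<or> msize J < msize (K + S) \<Longrightarrow>
    holomorphic_on_lines (w J)" "S = 0 \<or> box_level N = {}"
  shows "holomorphic_on_lines (\<lambda>x. elimination_step N K S x (\<lambda>J. w J x))"
  unfolding elimination_step_def lower_part_def
proof (intro holomorphic_on_lines_sum holomorphic_on_lines_mult holomorphic_on_lines_uminus
    holomorphic_on_lines_add)
  fix K2 assume K2: "K2 \<in> outside_level N"
  show "holomorphic_on_lines (level_adjugate N K K2)"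
    using level_elimination assms(1) K2 by (intro holomorphic_on_lines_polynomial) blast
  show "holomorphic_on_lines (principal_matrix K2 K')" for K'
    by (intro holomorphic_on_lines_polynomial principal_matrix_polynomial)
  show "holomorphic_on_lines (w (K' + S))" if "K' \<in> box_level N" for K'
    using that assms(3) by (intro assms(2)) (auto simp: box_level_def)
  show "holomorphic_on_lines (\<lambda>x. mellin_coeff (large_dir K2) x (large_base K2 + S) L)" for L
    by (intro holomorphic_on_lines_polynomial mellin_coeff_polynomial)
  show "holomorphic_on_lines (w (large_base K2 + S + L))" if "L \<in> {L. msize L < m}" for L
    using that K2 assms(1) msize_base[of K2] by (intro assms(2)) (auto simp: outside_level_def
      msize_add)
qed

text \<open>Only finitely many equations are presupposed, so that the clause applies to jets, for
  which finitely many equations hold on a common neighbourhood. The box case is fixed separately: an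
  identity for solutions alone would not determine \<open>R\<close> before solutions with arbitrary
  box values are available.\<close>

definition expresses :: "nat ^ 'n \<Rightarrow> (nat ^ 'n \<Rightarrow> complex ^ 'n \<Rightarrow> complex) \<Rightarrow> bool" where
  "expresses K R \<longleftrightarrow> (\<forall>I. holomorphic_on_lines (R I)) \<and>
     (K \<in> index_box m \<longrightarrow> (\<forall>I x. R I x = (if I = K then 1 else 0))) \<and>
     (\<forall>x u. discriminant x \<noteq> 0 \<longrightarrow> (\<forall>j J. msize J + m \<le> msize K \<longrightarrow> mellin_equation m mm x u j J) \<longrightarrow>
        u K = (\<Sum>I\<in>index_box m. R I x * u I))"

lemma expressesD:
  assumes "expresses K R"
  shows "holomorphic_on_lines (R I)" "K \<in> index_box m \<Longrightarrow> R I x = (if I = K then 1 else 0)"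
    "discriminant x \<noteq> 0 \<Longrightarrow> (\<And>j J. msize J + m \<le> msize K \<Longrightarrow> mellin_equation m mm x u j J) \<Longrightarrow>
       u K = (\<Sum>I\<in>index_box m. R I x * u I)"
  using assms unfolding expresses_def by simp_all

lemma box_sum: "K \<in> index_box m \<Longrightarrow> (\<Sum>I\<in>index_box m. (if I = K then 1 else 0) * u I) =
    (u K :: complex)"
  by (subst sum.remove[of _ K]) auto

lemma ex_expresses: "\<exists>R. expresses K R"
proof (induction "msize K" arbitrary: K rule: less_induct)
  case less
  have box: "\<exists>R. expresses K R" if "K \<in> index_box m" for K
  proof (intro exI)
    show "expresses K (\<lambda>I x. if I = K then 1 else 0)"
      unfolding expresses_def
      by (intro conjI allI impI holomorphic_on_lines_polynomial mv_polynomial_const refl) (simp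
        only: box_sum[OF that])
  qed
  show ?case
  proof (cases "K \<in> index_box m")
    case True
    then show ?thesis by (rule box)
  next
    case False
    then obtain N K1 S where K: "K = K1 + S" "K1 \<in> outside_level N" "N \<le> top_level" "S =
      0 \<or> box_level N = {}"
      by (rule level_cases)
    have "\<forall>J. \<exists>R. J \<in> index_box m \<or> msize J < msize K \<longrightarrow> expresses J R"
      using box less by blast
    then obtain RR where RR: "\<And>J. J \<in> index_box m \<or> msize J < msize (K1 + S) \<Longrightarrow> expresses J (RR J)"
      using K(1) by metis
    \<comment> \<open>An elimination step is linear in its last argument. Feeding it the coefficient
      functions of the earlier derivatives therefore produces those of \<open>K\<close>.\<close>
    define R where "R I x = elimination_step N K1 S x (\<lambda>J. RR J I x) / level_denominator N x" for I
      x
    have "holomorphic_on_lines (R I)" for I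
      unfolding R_def[abs_def]
    proof (intro holomorphic_on_lines_divide holomorphic_on_lines_step K(2,4))
      show "holomorphic_on_lines (RR J I)" if "J \<in> index_box m \<or> msize J < msize (K1 + S)" for J
        using RR[OF that] by (rule expressesD)
      show "holomorphic_on_lines (level_denominator N)"
        using level_elimination by (intro holomorphic_on_lines_polynomial) blast
      show "level_denominator N x \<noteq> 0" if "discriminant x \<noteq> 0" for x
        using that K(3) by (rule discriminant_pN)
    qed
    moreover have "u K = (\<Sum>I\<in>index_box m. R I x * u I)"
      if x: "discriminant x \<noteq> 0" and u: "\<forall>j J. msize J + m \<le> msize K \<longrightarrow>
        mellin_equation m mm x u j J" for x u
    proof -
      have p: "level_denominator N x \<noteq> 0" using x K(3) by (rule discriminant_pN)
      have "level_denominator N x * u K = elimination_step N K1 S x u"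
        unfolding K(1)
      proof (rule level_solve[OF K(2)])
        fix K2 assume K2: "K2 \<in> outside_level N"
        then show "mellin_equation m mm x u (large_dir K2) (large_base K2 + S)"
          using K(1,2) msize_base[of K2] by (intro u[rule_format]) (auto simp: outside_level_def
            msize_add)
      qed
      also have "\<dots> = elimination_step N K1 S x (\<lambda>J. \<Sum>I\<in>index_box m. RR J I x * u I)"
      proof (rule elimination_step_cong[OF _ K(2,4)])
        fix J :: "nat ^ 'n" assume J: "J \<in> index_box m \<or> msize J < msize (K1 + S)"
        show "u J = (\<Sum>I\<in>index_box m. RR J I x * u I)"
        proof (cases "J \<in> index_box m")
          case True
          then show ?thesis
            by (simp only: expressesD(2)[OF RR[OF J] True] box_sum)
        next
          case False
          with J have "msize J < msize K" using K(1) by simp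
          then show ?thesis
            by (intro expressesD(3)[OF RR[OF J] x] u[rule_format]) simp
        qed
      qed
      also have "\<dots> = (\<Sum>I\<in>index_box m. elimination_step N K1 S x (\<lambda>J. RR J I x) * u I)"
        by (rule elimination_step_sum)
      finally have "u K = (\<Sum>I\<in>index_box m. elimination_step N K1 S x (\<lambda>J. RR J I x) * u I) /
        level_denominator N x"
        using p by (simp add: field_simps)
      then show ?thesis
        by (simp add: R_def sum_divide_distrib)
    qed
    ultimately show ?thesis using False unfolding expresses_def by blast
  qed
qed

text \<open>Away from the zeros of \<^const>\<open>discriminant\<close>, the Mellin equations express every partial derivative
  \<open>K\<close> through the derivatives \<open>I\<close> in the box, with coefficients \<open>reduction_coeff K I\<close>.\<close>
definition reduction_coeff :: "nat ^ 'n \<Rightarrow> nat ^ 'n \<Rightarrow> complex ^ 'n \<Rightarrow> complex" where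
  "reduction_coeff K = (SOME R. expresses K R)"

lemma expresses_red: "expresses K (reduction_coeff K)"
  unfolding reduction_coeff_def by (rule someI_ex[OF ex_expresses])

lemmas holomorphic_on_lines_red = expressesD(1)[OF expresses_red]
lemmas reduction_coeff_box = expressesD(2)[OF expresses_red]
lemmas reduction = expressesD(3)[OF expresses_red]

section \<open>Growth of formal solutions\<close>

lemma mellin_coeff_bound:
  "\<exists>C\<ge>0. \<forall>j J L. msize L < m \<longrightarrow> norm (mellin_coeff j x J L) \<le> C * real (msize J + 1) ^ (m - msize L)"
proof -
  have "\<forall>j. \<exists>C\<ge>0. \<forall>J L. msize L \<le> m \<longrightarrow> norm (operator_coeff (mellin_factors m mm j) x J L) \<le>
    C * real (msize J + 1) ^ (m - msize L)"
    using operator_coeff_bound[of "mellin_factors m mm _" x] by (simp only: length_mops) blast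
  then obtain C where C: "\<And>j. C j \<ge> 0"
    "\<And>j J L. msize L \<le> m \<Longrightarrow> norm (operator_coeff (mellin_factors m mm j) x J L) \<le>
      C j * real (msize J + 1) ^ (m - msize L)"
    by metis
  have "norm (mellin_coeff j x J L) \<le> (\<Sum>j\<in>UNIV. C j) * real (msize J +
    1) ^ (m - msize L)" if "msize L < m" for j J L
  proof -
    have "L \<noteq> axis j m" using that by auto
    then have "norm (mellin_coeff j x J L) \<le> C j * real (msize J + 1) ^ (m - msize L)"
      using that C(2)[of L j J] by (simp add: mellin_coeff_def)
    also have "\<dots> \<le> (\<Sum>j\<in>UNIV. C j) * real (msize J + 1) ^ (m - msize L)"
      by (intro mult_right_mono member_le_sum) (auto simp: C)
    finally show ?thesis .
  qed
  moreover have "(\<Sum>j\<in>UNIV. C j) \<ge> 0" by (intro sum_nonneg C)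
  ultimately show ?thesis by blast
qed

text \<open>Induction on size with the bound \<open>A * B ^ msize K * fact (msize K)\<close>.
  Coefficient growth is absorbed by the factorials, and the constant of one elimination step by one
  factor \<open>B\<close>, because only derivatives of smaller size appear on the right.\<close>

lemma formal_solution_converges:
  assumes x: "discriminant x \<noteq> 0" and u: "\<And>j J. mellin_equation m mm x u j J"
  shows "convergent_coeffs u"
proof -
  obtain C where C: "C \<ge> 0" "\<And>j J L. msize L < m \<Longrightarrow> norm (mellin_coeff j x J L) \<le> C * real (msize J +
    1) ^ (m - msize L)"
    using mellin_coeff_bound[of x] by auto
  \<comment> \<open>Bounds one step uniformly in the index and the shift: the inverse matrix at the
    fixed point \<open>x\<close>, times the coefficient constant, times the number of lower-order
    terms. The constant \<open>A\<close> below covers the finitely many starting values.\<close>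
  define H where "H = (\<Sum>K1\<in>outside_level top_level. \<Sum>K2\<in>outside_level top_level. norm
    (level_adjugate top_level K1 K2 x) / norm (level_denominator top_level x) * (C * card {L :: nat
      ^ 'n. msize L < m}))"
  define B where "B = max 1 H"
  define A where "A = (\<Sum>K | msize K \<le> top_level. norm (u K))"
  have "B \<ge> 1" "H \<le> B" by (auto simp: B_def)
  have "A \<ge> 0" by (auto simp: A_def intro: sum_nonneg)
  have "norm (u K) \<le> A * B ^ msize K * fact (msize K)" for K
  proof (induction "msize K" arbitrary: K rule: less_induct)
    case less
    show ?case
    proof (cases "msize K \<le> top_level")
      case True
      have "norm (u K) \<le> A * 1 * 1"
        unfolding A_def using True by (simp, intro member_le_sum) auto
      also have "\<dots> \<le> A * B ^ msize K * fact (msize K)"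
        using \<open>A \<ge> 0\<close> \<open>B \<ge> 1\<close> by (intro mult_mono) auto
      finally show ?thesis .
    next
      case False
      then have K: "K \<notin> index_box m" "top_level \<le> msize K" using large_not_in_box[of K] by auto
      obtain K1 S where K1: "K = K1 + S" "K1 \<in> outside_level top_level"
        using level_cases[OF K(1)] K(2) by metis
      have p: "level_denominator top_level x \<noteq> 0" using x by (rule discriminant_pN) simp
      \<comment> \<open>The exponent is \<open>msize K - 1\<close> since the derivatives on the
        right have size at most that; the spared factor \<open>B\<close> pays for
        \<open>H\<close>.\<close>
      let ?X = "A * B ^ (msize K - 1) * fact (msize K)"
      have "?X \<ge> 0" using \<open>A \<ge> 0\<close> \<open>B \<ge> 1\<close> by simp
      have r: "norm (lower_part x top_level K2 S u) \<le>
        (C * card {L :: nat ^ 'n. msize L < m}) * ?X" if K2: "K2 \<in> outside_level top_level" for K2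
      proof -
        have s: "msize (large_base K2 + S) + m = msize K"
          using K1 K2 msize_base[of K2] by (auto simp: outside_level_def msize_add)
        have "norm (mellin_coeff (large_dir K2) x (large_base K2 + S) L * u (large_base K2 + S +
          L)) \<le> C * ?X" if L: "msize L < m" for L
        proof -
          let ?n = "msize (large_base K2 + S)"
          have lt: "msize (large_base K2 + S + L) < msize K"
            using s L by (simp add: msize_add)
          have "norm (u (large_base K2 + S + L)) \<le> A * B ^ msize (large_base K2 + S +
            L) * fact (msize (large_base K2 + S + L))"
            by (rule less[OF lt])
          also have "\<dots> \<le> A * B ^ (msize K - 1) * fact (?n + msize L)"
            using \<open>A \<ge> 0\<close> \<open>B \<ge> 1\<close> lt
            by (intro mult_mono power_increasing) (auto simp: msize_add)
          finally have "norm (mellin_coeff (large_dir K2) x (large_base K2 +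
            S) L * u (large_base K2 + S + L)) \<le>
              (C * real (?n + 1) ^ (m - msize L)) * (A * B ^ (msize K - 1) * fact (?n + msize L))"
            unfolding norm_mult using C L by (intro mult_mono) auto
          also have "\<dots> = C * (A * B ^ (msize K - 1) * real ((?n + 1) ^ (m - msize L) * fact (?n +
            msize L)))"
            by simp
          also have "\<dots> \<le> C * (A * B ^ (msize K - 1) * real (fact (?n + m)))"
            using power_mult_fact_le[of "msize L" m ?n] L \<open>C \<ge> 0\<close> \<open>A \<ge> 0\<close> \<open>B \<ge> 1\<close>
            by (intro mult_left_mono of_nat_mono) auto
          also have "\<dots> = C * ?X"
            by (simp add: s)
          finally show ?thesis .
        qed
        then have "norm (\<Sum>L | msize L < m. mellin_coeff (large_dir K2) x (large_base K2 +
          S) L * u (large_base K2 + S + L)) \<le>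
            (\<Sum>L\<in>{L :: nat ^ 'n. msize L < m}. C * ?X)"
          by (intro sum_norm_le) auto
        then show ?thesis
          unfolding lower_part_def box_level_N1 by (simp add: mult_ac)
      qed
      have "level_denominator top_level x * u K = elimination_step top_level K1 S x u"
        unfolding K1(1) using K1(2) u by (rule level_solve)
      then have "u K = elimination_step top_level K1 S x u / level_denominator top_level x"
        using p by (simp add: field_simps)
      then have "u K = (\<Sum>K2\<in>outside_level top_level. level_adjugate top_level K1 K2 x /
        level_denominator top_level x * lower_part x top_level K2 S u)"
        by (simp add: elimination_step_def sum_divide_distrib)
      then have "norm (u K) \<le> (\<Sum>K2\<in>outside_level top_level. norm (level_adjugate top_level K1 K2 x /
        level_denominator top_level x * lower_part x top_level K2 S u))"
        by (simp only: norm_sum)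
      also have "\<dots> \<le> (\<Sum>K2\<in>outside_level top_level. norm (level_adjugate top_level K1 K2 x) / norm
        (level_denominator top_level x) * ((C * card {L :: nat ^ 'n. msize L < m}) * ?X))"
        unfolding norm_mult norm_divide by (intro sum_mono mult_left_mono r) auto
      also have "\<dots> = (\<Sum>K2\<in>outside_level top_level. norm (level_adjugate top_level K1 K2 x) / norm
        (level_denominator top_level x) * (C * card {L :: nat ^ 'n. msize L < m})) * ?X"
        by (simp only: sum_distrib_right mult.assoc)
      also have "\<dots> \<le> H * ?X"
        unfolding H_def using C(1)
        by (intro mult_right_mono \<open>?X \<ge> 0\<close> member_le_sum[OF K1(2), where f =
          "\<lambda>K1. \<Sum>K2\<in>outside_level top_level. norm (level_adjugate top_level K1 K2 x) / norm
            (level_denominator top_level x) * (C * card {L :: nat ^ 'n. msize L < m})"])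
           (auto intro!: sum_nonneg mult_nonneg_nonneg)
      also have "\<dots> \<le> B * ?X"
        using \<open>H \<le> B\<close> \<open>?X \<ge> 0\<close> by (rule mult_right_mono)
      also have "\<dots> = A * (B * B ^ (msize K - 1)) * fact (msize K)"
        by simp
      also have "B * B ^ (msize K - 1) = B ^ msize K"
        using False by (simp add: power_eq_if)
      finally show ?thesis .
    qed
  qed
  moreover have "A * B ^ msize K * fact (msize K) \<le>
    A * (B * CARD('n)) ^ msize K * vfact K" for K :: "nat ^ 'n"
  proof -
    have "A * B ^ msize K * fact (msize K) \<le> A * B ^ msize K * (real CARD('n) ^ msize K * vfact K)"
      using \<open>A \<ge> 0\<close> \<open>B \<ge> 1\<close> by (intro mult_left_mono fact_le_vfact) auto
    then show ?thesis by (simp add: power_mult_distrib mult_ac)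
  qed
  moreover have "B * real CARD('n) \<ge> 1"
    using mult_mono[OF \<open>B \<ge> 1\<close>, of 1 "real CARD('n)"] \<open>B \<ge> 1\<close> by (simp add: Suc_leI)
  ultimately show ?thesis
    unfolding convergent_coeffs_def using \<open>A \<ge> 0\<close> by (meson order_trans)
qed

end

section \<open>Solutions at the origin and at generic points\<close>

lemma series_eval_isCont:
  fixes u :: "nat ^ 'n::finite \<Rightarrow> complex"
  assumes "convergent_coeffs u"
  shows "isCont (series_eval u) 0"
proof -
  obtain A B :: real where AB: "A \<ge> 0" "B \<ge> 1" "\<And>I. norm (u I) \<le> A * B ^ msize I * vfact I"
    using assms unfolding convergent_coeffs_def by auto
  define r where "r = 1 / (2 * B)"
  have "r > 0" using AB by (simp add: r_def)
  have small: "norm (h $ j) \<le> 1 / (2 * B)" if "h \<in> cball 0 r" for h :: "complex ^ 'n" and j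
    using that Finite_Cartesian_Product.norm_nth_le[of h j] by (simp add: r_def)
  have ul: "uniform_limit (cball 0 r) (\<lambda>F h. \<Sum>I\<in>F. u I / of_nat (vfact I) * mpow h I) (series_eval
    u) (finite_subsets_at_top UNIV)"
  proof (rule Weierstrass_m_test_general'[where M = "\<lambda>I. A * (1/2) ^ msize I"])
    show "norm (u I / of_nat (vfact I) * mpow h I) \<le> A * (1/2) ^ msize I"
      if "h \<in> cball 0 r" for I h
      by (rule series_eval_term_bound[OF AB(3,1,2) small[OF that]])
    show "((\<lambda>I. u I / of_nat (vfact I) * mpow h I) has_sum series_eval u h) UNIV" if "h \<in> cball 0 r"
      for h
      by (rule series_eval_has_sum_explicit[OF AB(3,1,2) small[OF that]])
  qed (rule half_summable)
  have "continuous_on (cball 0 r) (series_eval u)"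
  proof (rule uniform_limit_theorem[OF _ ul])
    show "\<forall>\<^sub>F F in finite_subsets_at_top UNIV. continuous_on (cball 0 r) (\<lambda>h. \<Sum>I\<in>F. u I / of_nat
      (vfact I) * mpow h I)"
      unfolding mpow_def by (intro always_eventually allI continuous_intros)
  qed simp
  then have "continuous_on (ball 0 r) (series_eval u)"
    by (rule continuous_on_subset) auto
  then show ?thesis
    using \<open>r > 0\<close> by (simp add: continuous_on_eq_continuous_at)
qed

lemma prod_lessThan_split: "(\<Prod>q<k + l. f q) = (\<Prod>q<k. f q) * (\<Prod>q<l. f (k + q) :: complex)"
  for k l :: nat
  by (induction l) (simp_all add: mult.assoc)

context mellin_data begin

text \<open>The zeros of a nonconstant entire function are countable, and the plane minus a
  countable set is path connected. In the constant case the value is \<open>discriminant 0\<close>,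
  so the whole line is regular.\<close>

lemma connected_regular_line: "connected {t. discriminant (t *s a) \<noteq> 0}" (is "connected ?D")
proof -
  have hol: "(\<lambda>t. discriminant (t *s a)) holomorphic_on UNIV"
    by (rule mv_polynomial_holomorphic_line[OF discriminant_polynomial])
  show ?thesis
  proof (cases "(\<lambda>t. discriminant (t *s a)) constant_on UNIV")
    case True
    then obtain c where c: "\<And>t. discriminant (t *s a) = c"
      unfolding constant_on_def by auto
    with discriminant_0 have "c \<noteq> 0"
      using c[of 0] by simp
    then have "?D = UNIV" using c by auto
    then show ?thesis by (simp add: connected_UNIV)
  next
    case False
    then have "countable {t \<in> UNIV. discriminant (t *s a) = 0}"
      by (intro holomorphic_countable_zeros[OF hol]) auto
    then have "connected (- {t. discriminant (t *s a) = 0})"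
      by (intro path_connected_imp_connected path_connected_complement_countable) auto
    moreover have "- {t. discriminant (t *s a) = 0} = ?D"
      by auto
    ultimately show ?thesis by simp
  qed
qed

lemma open_regular_line: "open {t. discriminant (t *s a) \<noteq> 0}"
proof -
  have "continuous_on UNIV (\<lambda>t. discriminant (t *s a))"
    by (rule holomorphic_on_imp_continuous_on mv_polynomial_holomorphic_line
      discriminant_polynomial)+
  then have "open ((\<lambda>t. discriminant (t *s a)) -` (- {0}))"
    by (intro open_vimage) auto
  then show ?thesis
    by (simp add: vimage_def)
qed

text \<open>On the line \<open>t *s a\<close> the origin is \<open>t = 0\<close> and the target is
  \<open>t = 1\<close>; both lie in one connected open set, so the one-variable identity theorem
  applies.\<close>

lemma holomorphic_on_lines_identity:
  assumes g: "holomorphic_on_lines g" and "\<forall>\<^sub>F x in nhds 0. g x = 0" and a: "discriminant a \<noteq> 0"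
  shows "g a = 0"
proof -
  let ?D = "{t. discriminant (t *s a) \<noteq> 0}"
  have "filterlim (\<lambda>t. t *s a) (nhds 0) (nhds (0 :: complex))"
  proof (rule vec_tendstoI)
    show "((\<lambda>t. (t *s a) $ i) \<longlongrightarrow> 0 $ i) (nhds (0 :: complex))" for i
      using tendsto_mult_right[OF filterlim_ident[of "nhds (0 :: complex)"], of "a $ i"] by (simp
        add: mult.commute)
  qed
  with assms(2) have "\<forall>\<^sub>F t in nhds 0. g (t *s a) = 0"
    by (rule eventually_compose_filterlim)
  then obtain U where U: "open U" "0 \<in> U" "\<And>t. t \<in> U \<Longrightarrow> g (t *s a) = 0"
    by (auto simp: eventually_nhds)
  have "g (1 *s a) = 0"
  proof (rule analytic_continuation_open[of "U \<inter> ?D" ?D "\<lambda>t. g (t *s a)" "\<lambda>t. 0" 1])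
    show "open (U \<inter> ?D)" using U open_regular_line by blast
    show "U \<inter> ?D \<noteq> {}" using U discriminant_0 by (auto intro!: exI[of _ 0])
    show "(\<lambda>t. g (t *s a)) holomorphic_on ?D" using g by (simp add: holomorphic_on_lines_def)
  qed (use U open_regular_line connected_regular_line a in auto)
  then show ?thesis by simp
qed

section \<open>Two-term recurrences at the origin\<close>

definition dotp :: "('n \<Rightarrow> nat) \<Rightarrow> nat ^ 'n \<Rightarrow> nat" where
  "dotp a I = (\<Sum>j\<in>UNIV. a j * I $ j)"

lemma dotp_add: "dotp a (I + J) = dotp a I + dotp a J"
  by (simp add: dotp_def distrib_left sum.distrib)

lemma dotp_axis: "dotp a (axis j k) = a j * k"
  by (simp add: dotp_def axis_def if_distrib sum.delta cong: if_cong)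

text \<open>Monomials are eigenvectors of theta forms: the exponent \<open>J\<close> has eigenvalue
  \<open>of_nat (dotp a J) + c\<close>.\<close>

lemma theta_forms_coeff_0: "theta_forms_coeff ops 0 u J = (\<Prod>(a, c)\<leftarrow>ops. of_nat (dotp a J) +
    c) * u J"
proof (induction ops)
  case (Cons op ops)
  obtain a c where op: "op = (a, c)" by force
  show ?case
    by (simp add: op theta_form_coeff_def theta_coeff_def Cons.IH dotp_def sum_distrib_right
      distrib_right mult.assoc)
qed simp

lemma mellin_equation_0_iff:
  "mellin_equation m mm 0 u j J \<longleftrightarrow>
     (\<Prod>q<mm j. of_nat (dotp mm J + m * q) + 1) *
       (\<Prod>q<m - mm j. of_nat (dotp (\<lambda>i. m - mm i) J + m * q) - 1) * u J = kappa j * u (J + axis j m)"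
proof -
  have *: "prod_list (map f [0..<k]) = (\<Prod>q<k. f q)" for f :: "nat \<Rightarrow> complex" and k
    by (induction k) (simp_all add: mult.commute)
  show ?thesis
    by (simp add: mellin_equation_def theta_forms_coeff_0 mellin_factors_def kappa_def o_def *
      add.assoc diff_add_eq[symmetric] add_diff_eq)
qed

definition index_mod :: "nat ^ 'n \<Rightarrow> nat ^ 'n" where "index_mod J = (\<chi> j. J $ j mod m)"
definition index_div :: "nat ^ 'n \<Rightarrow> nat ^ 'n" where "index_div J = (\<chi> j. J $ j div m)"
definition index_scale :: "nat ^ 'n \<Rightarrow> nat ^ 'n" where "index_scale K = (\<chi> j. m * K $ j)"

lemma index_mod_idiv: "index_mod J + index_scale (index_div J) = J"
  by (simp add: vec_eq_iff index_mod_def index_div_def index_scale_def)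

lemma index_mod_box: "I \<in> index_box m \<Longrightarrow> index_mod (I + index_scale K) = I"
  using m_pos by (simp add: mem_index_box index_mod_def index_scale_def vec_eq_iff)

lemma index_div_box: "I \<in> index_box m \<Longrightarrow> index_div (I + index_scale K) = K"
  using m_pos by (simp add: mem_index_box index_div_def index_scale_def vec_eq_iff)

lemma index_mod_step: "index_mod (J + axis j m) = index_mod J"
  by (auto simp: index_mod_def vec_eq_iff axis_def)

lemma index_div_step: "index_div (J + axis j m) = index_div J + axis j 1"
  using m_pos by (auto simp: index_div_def vec_eq_iff axis_def)

lemma dotp_iscale: "dotp a (index_scale K) = m * dotp a K"
  by (simp add: dotp_def index_scale_def sum_distrib_left mult_ac)

text \<open>The formal solution at the origin whose Taylor coefficients in the box are prescribed by
  \<open>v\<close>; at the origin the Mellin equations are two-term recurrences.\<close>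
definition origin_solution :: "(nat ^ 'n \<Rightarrow> complex) \<Rightarrow> nat ^ 'n \<Rightarrow> complex" where
  "origin_solution v J = v (index_mod J) *
     (\<Prod>q<dotp mm (index_div J). of_nat (dotp mm (index_mod J) + m * q) + 1) *
     (\<Prod>q<dotp (\<lambda>i. m - mm i) (index_div J). of_nat (dotp (\<lambda>i. m - mm i) (index_mod J) +
       m * q) - 1) /
     (\<Prod>i\<in>UNIV. kappa i ^ (index_div J $ i))"

text \<open>Replacing \<open>K\<close> by \<open>K + axis j 1\<close> lengthens the two products by
  \<open>mm j\<close> and \<open>m - mm j\<close> factors and adds one factor \<open>kappa j\<close>
  to the denominator. Since \<open>dotp a J + m * q = dotp a I + m * (dotp a K + q)\<close>, the new
  factors are exactly those of the recurrence.\<close>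

lemma origin_solution_meq: "mellin_equation m mm 0 (origin_solution v) j J"
proof -
  define I K where "I = index_mod J" and "K = index_div J"
  have J: "J = I + index_scale K"
    by (simp add: I_def K_def index_mod_idiv)
  have d: "dotp a J + m * q = dotp a I + m * (dotp a K + q)" for a q
    by (simp add: J dotp_add dotp_iscale algebra_simps)
  let ?D = "\<Prod>i\<in>UNIV. kappa i ^ (K $ i)"
  have D: "(\<Prod>i\<in>UNIV. kappa i ^ ((K + axis j 1) $ i)) = kappa j * ?D"
    by (subst (1 2) prod.remove[of UNIV j]) (auto simp: axis_def intro!: prod.cong)
  have split: "(\<Prod>q<dotp a (K + axis j 1). f q) = (\<Prod>q<dotp a K. f q) * (\<Prod>q<a j. f (dotp a K +
    q) :: complex)" for a f
    by (simp only: dotp_add dotp_axis mult_1_right prod_lessThan_split)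
  have alg: "a1 * b1 * (c * a0 * b0 / e) = k * (c * (a0 * a1) * (b0 * b1) / (k * e))" if "k \<noteq> 0" for
    a0 a1 b0 b1 c e k :: complex
    using that by simp
  show ?thesis
    unfolding mellin_equation_0_iff d origin_solution_def index_mod_step index_div_step
    unfolding I_def[symmetric] K_def[symmetric] D split
    by (rule alg[OF kappa_nonzero])
qed

lemma origin_solution_box:
  assumes "I \<in> index_box m"
  shows "origin_solution v I = v I"
proof -
  have "index_scale 0 = 0" by (simp add: index_scale_def vec_eq_iff)
  then have "index_mod I = I" "index_div I = 0"
    using index_mod_box[OF assms, of 0] index_div_box[OF assms, of 0] by simp_all
  then show ?thesis
    by (simp add: origin_solution_def dotp_def)
qed

section \<open>The fundamental matrix near the origin and continuation to generic points\<close>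

definition delta :: "nat ^ 'n \<Rightarrow> nat ^ 'n \<Rightarrow> complex" where
  "delta I J = (if J = I then 1 else 0)"

lemma convergent_coeffs_osol: "convergent_coeffs (origin_solution v)"
  by (rule formal_solution_converges[OF discriminant_0 origin_solution_meq])

lemma jet_meq:
  assumes "convergent_coeffs u" "\<And>j J. mellin_equation m mm 0 u j J"
  shows "\<forall>\<^sub>F h in nhds 0. mellin_equation m mm h (jet u h) j J"
proof -
  have "theta_forms_coeff (mellin_factors m mm j) 0 u = (\<lambda>I. kappa j * u (I + axis j m))"
    using assms(2)[of j] by (auto simp: mellin_equation_def kappa_def)
  then have "jet (theta_forms_coeff (mellin_factors m mm j) 0 u) h J = kappa j * jet u h (J +
    axis j m)" for h
    by (simp add: jet_def series_eval_scale ac_simps)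
  moreover have "\<forall>\<^sub>F h in nhds 0. jet (theta_forms_coeff (mellin_factors m mm j) 0 u) h J =
    theta_forms_coeff (mellin_factors m mm j) h (jet u h) J"
    by (rule jet_tfs[OF assms(1)])
  ultimately show ?thesis
    by (simp add: mellin_equation_def kappa_def eq_commute)
qed

text \<open>At 0 the matrix is the identity by the choice of box values. Elimination in the class of
  functions continuous at 0 then gives a scalar \<open>p\<close> that stays nonzero nearby and
  annihilates the kernel.\<close>

lemma wronskian_nonsingular:
  "\<forall>\<^sub>F h in nhds 0. \<forall>Z. (\<forall>I\<in>index_box m. (\<Sum>K\<in>index_box m. jet (origin_solution (delta I)) h K * Z K)
    = 0) \<longrightarrow>
     (\<forall>I\<in>index_box m. Z I = 0)"
proof -
  let ?M = "\<lambda>I K h. jet (origin_solution (delta I)) h K"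
  have "\<exists>p adj. isCont p 0 \<and> p 0 \<noteq> 0 \<and> (\<forall>i\<in>index_box m. \<forall>j\<in>index_box m. isCont (adj i j) 0) \<and>
    scaled_left_inverse (index_box m) ?M p adj"
  proof (rule elimination)
    show "isCont (?M I K) 0" for I K
      unfolding jet_def[abs_def] by (rule series_eval_isCont) (rule convergent_coeffs_shift[OF
        convergent_coeffs_osol])
    show "?M I I 0 \<noteq> 0" if "I \<in> index_box m" for I
      using that by (simp add: jet_0 origin_solution_box delta_def)
    show "?M I K 0 = 0" if "I \<in> index_box m" "K \<in> index_box m" "I \<noteq> K" for I K
      using that by (simp add: jet_0 origin_solution_box delta_def)
  qed (auto intro: continuous_intros)
  then obtain p adj where p: "isCont p 0" "p 0 \<noteq> 0" and inv: "scaled_left_inverse (index_box m) ?M p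
    adj"
    by blast
  have "\<forall>\<^sub>F h in nhds 0. p h \<noteq> 0"
    using p by (intro tendsto_imp_eventually_ne) (auto simp: continuous_at
      tendsto_at_iff_tendsto_nhds)
  then show ?thesis
  proof eventually_elim
    case (elim h)
    show ?case
    proof (intro allI impI ballI)
      fix Z and I :: "nat ^ 'n"
      assume Z: "\<forall>I\<in>index_box m. (\<Sum>K\<in>index_box m. jet (origin_solution (delta I)) h K * Z K) =
        0" and I: "I \<in> index_box m"
      have "p h * Z I = (\<Sum>j\<in>index_box m. adj I j h * 0)"
        by (rule scaled_left_inverseD[OF inv]) (use Z I in auto)
      with elim show "Z I = 0" by simp
    qed
  qed
qed

text \<open>The Mellin equations for \<open>\<lambda>K. reduction_coeff K I a\<close> hold near the origin because genuine
    solutions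
  exist there, and they propagate to all regular points by the identity theorem.\<close>
lemma reduction_coeff_meq:
  assumes a: "discriminant a \<noteq> 0" and I: "I \<in> index_box m"
  shows "mellin_equation m mm a (\<lambda>K. reduction_coeff K I a) j J"
proof -
  \<comment> \<open>The defect of the relation \<open>J\<close> of equation \<open>j\<close>; it has
    to vanish at \<open>a\<close>.\<close>
  define g where "g I x = (\<Sum>L | msize L \<le> m. mellin_coeff j x J L * reduction_coeff (J +
    L) I x)" for I x
  have "holomorphic_on_lines (g I)"
    unfolding g_def[abs_def] by (intro holomorphic_on_lines_sum holomorphic_on_lines_mult
      holomorphic_on_lines_red holomorphic_on_lines_polynomial mellin_coeff_polynomial)
  moreover have "\<forall>\<^sub>F x in nhds 0. g I x = 0"
  proof -
    \<comment> \<open>Sizes up to \<open>msize J\<close> suffice: the relation involves derivatives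
      of size at most \<open>msize J + m\<close>, and reducing these uses no further
      equations.\<close>
    have "\<forall>\<^sub>F h in nhds 0. \<forall>i\<in>UNIV. \<forall>J'\<in>{J'. msize J' \<le>
      msize J}. \<forall>I0\<in>index_box m. mellin_equation m mm h (jet (origin_solution (delta I0)) h) i J'"
      by (intro eventually_ball_finite ballI jet_meq convergent_coeffs_osol origin_solution_meq)
        auto
    moreover have "\<forall>\<^sub>F h in nhds 0. discriminant h \<noteq> 0"
    proof (rule tendsto_imp_eventually_ne[OF _ discriminant_0])
      show "(discriminant \<longlongrightarrow> discriminant 0) (nhds 0)"
        using mv_polynomial_continuous[OF discriminant_polynomial]
        by (simp add: continuous_on_eq_continuous_at continuous_at tendsto_at_iff_tendsto_nhds)
    qed
    ultimately show ?thesis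
      using wronskian_nonsingular
    proof eventually_elim
      case (elim h)
      have "(\<Sum>K\<in>index_box m. jet (origin_solution (delta I0)) h K * g K h) =
        0" if I0: "I0 \<in> index_box m" for I0
      proof -
        let ?v = "jet (origin_solution (delta I0)) h"
        have v: "?v (J + L) = (\<Sum>K\<in>index_box m. reduction_coeff (J + L) K h * ?v K)" if "msize L \<le>
          m" for L
        proof (rule reduction[OF elim(2)])
          fix i and J' :: "nat ^ 'n"
          assume "msize J' + m \<le> msize (J + L)"
          with that have "msize J' \<le> msize J" by (simp add: msize_add)
          then show "mellin_equation m mm h ?v i J'"
            using elim(1)[rule_format, of i J' I0] I0 by simp
        qed
        have "mellin_equation m mm h ?v j J"
          using elim(1)[rule_format, of j J I0] I0 by simp
        then have "0 = (\<Sum>L | msize L \<le> m. mellin_coeff j h J L * ?v (J + L))"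
          by (simp add: mellin_equation_iff_co)
        also have "\<dots> = (\<Sum>L | msize L \<le> m. \<Sum>K\<in>index_box m. ?v K * (mellin_coeff j h J L *
          reduction_coeff (J + L) K h))"
        proof (rule sum.cong[OF refl])
          fix L :: "nat ^ 'n" assume "L \<in> {L. msize L \<le> m}"
          then have "mellin_coeff j h J L * ?v (J + L) = mellin_coeff j h J L * (\<Sum>K\<in>index_box m.
            reduction_coeff (J + L) K h * ?v K)"
            using v[of L] by simp
          also have "\<dots> = (\<Sum>K\<in>index_box m. ?v K * (mellin_coeff j h J L * reduction_coeff (J +
            L) K h))"
            by (simp only: sum_distrib_left mult_ac)
          finally show "mellin_coeff j h J L * ?v (J + L) = \<dots>" .
        qed
        also have "\<dots> = (\<Sum>K\<in>index_box m. ?v K * g K h)"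
          unfolding g_def sum_distrib_left by (rule sum.swap)
        finally show ?thesis by simp
      qed
      \<comment> \<open>Every row of the fundamental matrix annihilates the vector of defects, and
        the matrix is nonsingular at \<open>h\<close>.\<close>
      then show "g I h = 0"
        using elim(3)[rule_format, of "\<lambda>K. g K h" I] I by simp
    qed
  qed
  ultimately have "g I a = 0"
    using a by (rule holomorphic_on_lines_identity)
  then show ?thesis
    by (simp add: g_def mellin_equation_iff_co)
qed

text \<open>Box coefficients are coordinates: they read off the constants of a linear combination,
  and by \<open>reduction\<close> they determine every further coefficient. Applied to
  \<open>w I\<close> itself, \<open>reduction\<close> shows
  \<open>w I K = reduction_coeff K I a\<close>, whence spanning. Convergence comes from
  \<open>formal_solution_converges\<close>, so formal data suffice both at generic points and at the
  origin.\<close>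

lemma germ_basis_of_formal:
  assumes a: "discriminant a \<noteq> 0"
    and w: "\<And>I j J. I \<in> index_box m \<Longrightarrow> mellin_equation m mm a (w I) j J"
    and w_box: "\<And>I J. I \<in> index_box m \<Longrightarrow> J \<in> index_box m \<Longrightarrow> w I J = (if J = I then 1 else 0)"
  shows "germ_basis a (mellin_solutions m mm a) (index_box m) (\<lambda>I x. series_eval (w I) (x - a))"
proof -
  have has_taylor: "has_taylor (\<lambda>x. series_eval (w I) (x - a)) a (w I)" if "I \<in> index_box m" for I
    using formal_solution_converges[OF a w[OF that]] by (simp add: has_taylor_def)
  have comb: "has_taylor (\<lambda>x. \<Sum>I\<in>index_box m. c I * series_eval (w I) (x - a)) a (\<lambda>J. \<Sum>I\<in>index_box
    m. c I * w I J)" for c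
    by (intro has_taylor_sum has_taylor_scale has_taylor)
  show ?thesis
    unfolding germ_basis_def
  proof (intro conjI ballI allI impI)
    show "(\<lambda>x. series_eval (w I) (x - a)) \<in> mellin_solutions m mm a" if "I \<in> index_box m" for I
      unfolding mellin_solutions_iff[OF has_taylor[OF that]] using w[OF that] by blast
  next
    fix c and J :: "nat ^ 'n"
    assume c: "\<forall>\<^sub>F x in nhds a. (\<Sum>I\<in>index_box m. c I * series_eval (w I) (x - a)) =
      0" and J: "J \<in> index_box m"
    have "(\<lambda>J. \<Sum>I\<in>index_box m. c I * w I J) = (\<lambda>J. 0)"
      by (rule has_taylor_unique[OF comb has_taylor_0 c])
    then have "(\<Sum>I\<in>index_box m. c I * w I J) = 0"
      by (rule fun_cong)
    also have "(\<Sum>I\<in>index_box m. c I * w I J) = c J"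
      using J by (subst sum.remove[of _ J]) (auto simp: w_box intro!: sum.neutral split: if_splits)
    finally show "c J = 0" .
  next
    fix y assume y: "y \<in> mellin_solutions m mm a"
    then obtain u where u: "has_taylor y a u"
      by (auto simp: mellin_solutions_def mv_analytic_at_iff)
    with y have mellin_equation: "\<And>j J. mellin_equation m mm a u j J"
      by (simp add: mellin_solutions_iff)
    have "u K = (\<Sum>I\<in>index_box m. u I * w I K)" for K
    proof -
      have wK: "w I K = reduction_coeff K I a" if I: "I \<in> index_box m" for I :: "nat ^ 'n"
      proof -
        have "w I K = (\<Sum>J\<in>index_box m. reduction_coeff K J a * w I J)"
          by (rule reduction[OF a]) (rule w[OF I])
        also have "\<dots> = reduction_coeff K I a"
          using I by (subst sum.remove[of _ I]) (auto simp: w_box intro!: sum.neutral)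
        finally show ?thesis .
      qed
      have "u K = (\<Sum>I\<in>index_box m. reduction_coeff K I a * u I)"
        by (rule reduction[OF a]) (rule mellin_equation)
      then show ?thesis
        by (simp add: wK mult.commute)
    qed
    then have "u = (\<lambda>K. \<Sum>I\<in>index_box m. u I * w I K)"
      by blast
    then have "has_taylor y a (\<lambda>K. \<Sum>I\<in>index_box m. u I * w I K)"
      using u by simp
    then show "\<exists>c. \<forall>\<^sub>F x in nhds a. y x = (\<Sum>I\<in>index_box m. c I * series_eval (w I) (x - a))"
      using has_taylor_eq[OF _ comb] by blast
  qed simp
qed

lemma generic_basis:
  assumes "discriminant a \<noteq> 0"
  shows "germ_basis a (mellin_solutions m mm a) (index_box m) (\<lambda>I x. series_eval (\<lambda>K.
    reduction_coeff K I a) (x - a))"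
  by (rule germ_basis_of_formal[OF assms]) (auto simp: reduction_coeff_meq[OF assms]
    reduction_coeff_box)

lemma origin_basis:
  "germ_basis 0 (mellin_solutions m mm 0) (index_box m) (\<lambda>I. series_eval (origin_solution (delta
    I)))"
  using germ_basis_of_formal[OF discriminant_0, of "\<lambda>I. origin_solution (delta I)"]
  by (simp add: origin_solution_meq origin_solution_box delta_def)

text \<open>The factorials convert between normalisations: from derivatives in \<open>x\<close> at
  the exponent \<open>I + index_scale K\<close> to derivatives in the variables \<open>x_j^m\<close>
  at the exponent \<open>K\<close>.\<close>

definition reduced :: "nat ^ 'n \<Rightarrow> nat ^ 'n \<Rightarrow> complex" where
  "reduced I K = origin_solution (delta I) (I + index_scale K) / of_nat (vfact (I +
    index_scale K)) * of_nat (vfact K)"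

lemma msize_iscale: "msize (index_scale K) = m * msize K"
  by (simp add: msize_def index_scale_def sum_distrib_left)

lemma convergent_coeffs_reduced: "convergent_coeffs (reduced I)"
proof -
  obtain A B :: real where AB: "A \<ge> 0" "B \<ge> 1" "\<And>J. norm (origin_solution (delta I) J) \<le>
    A * B ^ msize J * vfact J"
    using convergent_coeffs_osol[of "delta I"] unfolding convergent_coeffs_def by auto
  have "norm (reduced I K) \<le> (A * B ^ msize I) * (B ^ m) ^ msize K * vfact K" for K
  proof -
    have "norm (origin_solution (delta I) (I + index_scale K)) / vfact (I + index_scale K) \<le>
      A * B ^ msize (I + index_scale K)"
      using AB(3)[of "I + index_scale K"] by (simp add: field_simps)
    also have "\<dots> = (A * B ^ msize I) * (B ^ m) ^ msize K"
      by (simp add: msize_add msize_iscale power_add power_mult)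
    finally show ?thesis
      unfolding reduced_def norm_mult norm_divide norm_of_nat by (rule mult_right_mono) simp
  qed
  moreover have "A * B ^ msize I \<ge> 0" "B ^ m \<ge> 1"
    using AB by auto
  ultimately show ?thesis
    unfolding convergent_coeffs_def by blast
qed

text \<open>The recurrences move by m in one coordinate, so the solution started at \<open>I\<close>
  is supported on the exponents congruent to \<open>I\<close> modulo m. Reindexing is a rule for
  infinite sums as such, so the identity holds at every \<open>x\<close>.\<close>

lemma series_eval_osol_factor:
  assumes I: "I \<in> index_box m"
  shows "series_eval (origin_solution (delta I)) x = mpow x I * series_eval (reduced I) (\<chi> j. (x $
    j) ^ m)"
proof -
  let ?t = "\<lambda>J. origin_solution (delta I) J / of_nat (vfact J) * mpow x J"
  have inj: "inj (\<lambda>K. I + index_scale K)"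
    using m_pos by (auto simp: inj_def index_scale_def vec_eq_iff)
  have zero: "origin_solution (delta I) J = 0" if "J \<notin> range (\<lambda>K. I + index_scale K)" for J
  proof -
    have "index_mod J \<noteq> I"
      using that index_mod_idiv[of J] by (metis rangeI)
    then show ?thesis by (simp add: origin_solution_def delta_def)
  qed
  have mp: "mpow x (index_scale K) = mpow (\<chi> j. (x $ j) ^ m) K" for K
    by (simp add: mpow_def index_scale_def power_mult)
  have "series_eval (origin_solution (delta I)) x = infsum ?t (range (\<lambda>K. I + index_scale K))"
    unfolding series_eval_def by (rule infsum_cong_neutral) (auto simp: zero)
  also have "\<dots> = (\<Sum>\<^sub>\<infinity>K. ?t (I + index_scale K))"
    by (subst infsum_reindex[OF inj]) (simp add: o_def)
  also have "\<dots> = (\<Sum>\<^sub>\<infinity>K. mpow x I * (reduced I K / of_nat (vfact K) * mpow (\<chi> j. (x $ j) ^ m) K))"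
    by (intro infsum_cong) (simp add: mpow_add mp reduced_def)
  also have "\<dots> = mpow x I * series_eval (reduced I) (\<chi> j. (x $ j) ^ m)"
    unfolding series_eval_def by (rule infsum_cmult_right')
  finally show ?thesis .
qed

text \<open>The value is \<open>1 / of_nat (vfact I)\<close>: the starting coefficient is 1,
  whatever factors of the recurrence vanish later.\<close>

lemma reduced_0: "I \<in> index_box m \<Longrightarrow> series_eval (reduced I) 0 \<noteq> 0"
proof -
  assume I: "I \<in> index_box m"
  have "index_scale 0 = 0" by (simp add: index_scale_def vec_eq_iff)
  then show ?thesis
    using I by (simp add: series_eval_zero reduced_def origin_solution_box delta_def)
qed

section \<open>Counting the box and the holonomic rank\<close>

lemma card_index_box: "card (index_box m :: (nat ^ 'n) set) = m ^ CARD('n)"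
proof -
  have "bij_betw vec_nth (index_box m :: (nat ^ 'n) set) (UNIV \<rightarrow>\<^sub>E {..<m})"
    by (rule bij_betwI[where g = vec_lambda]) (auto simp: mem_index_box m_pos PiE_def Pi_def)
  then show ?thesis
    by (auto dest!: bij_betw_same_card simp: card_PiE)
qed

lemma germ_basis_reindex:
  assumes "germ_basis a S A f" "bij_betw h B A"
  shows "germ_basis a S B (f \<circ> h)"
proof -
  have sum: "(\<Sum>i\<in>B. c (h i) * f (h i) x) = (\<Sum>i\<in>A. c i * f i x)" for c x
    using sum.reindex_bij_betw[OF assms(2), of "\<lambda>i. c i * f i x"] .
  have img: "h ` B = A" and inj: "inj_on h B"
    using assms(2) by (auto simp: bij_betw_def)
  have ind: "\<And>c. \<forall>\<^sub>F x in nhds a. (\<Sum>i\<in>A. c i * f i x) = 0 \<Longrightarrow> \<forall>i\<in>A. c i = 0"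
    and span: "\<And>g. g \<in> S \<Longrightarrow> \<exists>c. \<forall>\<^sub>F x in nhds a. g x = (\<Sum>i\<in>A. c i * f i x)"
    and mem: "finite A" "\<And>i. i \<in> A \<Longrightarrow> f i \<in> S"
    using assms(1) unfolding germ_basis_def by blast+
  show ?thesis
    unfolding germ_basis_def
  proof (intro conjI allI ballI impI)
    show "finite B" using mem(1) assms(2) by (simp add: bij_betw_finite)
    show "(f \<circ> h) i \<in> S" if "i \<in> B" for i
      using that mem(2) img by auto
  next
    fix c i assume c: "\<forall>\<^sub>F x in nhds a. (\<Sum>i\<in>B. c i * (f \<circ> h) i x) = 0" and i: "i \<in> B"
    define d where "d k = c (the_inv_into B h k)" for k
    have d: "d (h i) = c i" if "i \<in> B" for i
      using that inj by (simp add: d_def the_inv_into_f_f)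
    have "(\<Sum>i\<in>B. c i * (f \<circ> h) i x) = (\<Sum>i\<in>A. d i * f i x)" for x
      unfolding sum[symmetric] by (intro sum.cong) (auto simp: d)
    with c have "\<forall>i\<in>A. d i = 0"
      by (intro ind) simp
    then show "c i = 0"
      using d[OF i] img i by auto
  next
    fix g assume "g \<in> S"
    then obtain c where "\<forall>\<^sub>F x in nhds a. g x = (\<Sum>i\<in>A. c i * f i x)"
      using span by blast
    then show "\<exists>c. \<forall>\<^sub>F x in nhds a. g x = (\<Sum>i\<in>B. c i * (f \<circ> h) i x)"
      by (intro exI[of _ "c \<circ> h"]) (simp add: sum)
  qed
qed

lemma holonomic_rank: "has_holonomic_rank m mm (m ^ CARD('n))"
  unfolding has_holonomic_rank_def
proof (intro exI[of _ discriminant] conjI allI impI discriminant_polynomial)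
  show "\<exists>x. discriminant x \<noteq> 0" using discriminant_0 by blast
  fix a assume a: "discriminant a \<noteq> 0"
  obtain h where h: "bij_betw h {..<m ^ CARD('n)} (index_box m :: (nat ^ 'n) set)"
    using ex_bij_betw_nat_finite[OF finite_index_box[of m, where ?'a = 'n]]
    by (auto simp: card_index_box atLeast0LessThan)
  show "has_germ_dim a (mellin_solutions m mm a) (m ^ CARD('n))"
    unfolding has_germ_dim_def using germ_basis_reindex[OF generic_basis[OF a] h] by blast
qed

end

theorem theorem2p1:
  fixes m :: nat and mm :: "'n::{finite,linorder} \<Rightarrow> nat"
  assumes "\<And>j. mm j < m"
    and "\<And>i j. i < j \<Longrightarrow> mm j < mm i"
    and "\<And>j. 0 < mm j"
  shows "has_holonomic_rank m mm (m ^ CARD('n)) \<and>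
    (\<exists>f ft.
       germ_basis 0 (mellin_solutions m mm 0) (index_box m) f \<and>
       (\<forall>I\<in>index_box m.
          mv_analytic_at (ft I) 0 \<and> ft I 0 \<noteq> 0 \<and>
          (\<forall>\<^sub>F x in nhds 0. f I x = mpow x I * ft I (\<chi> j. (x $ j) ^ m))))"
proof -
  interpret mellin_data m mm
    by unfold_locales (use assms in auto)
  have "mv_analytic_at (series_eval (reduced I)) 0" for I
    unfolding mv_analytic_at_iff by (intro exI[of _ "reduced I"]) (simp add: has_taylor_def convergent_coeffs_reduced)
  then show ?thesis
    using holonomic_rank origin_basis reduced_0 series_eval_osol_factor
    by (intro conjI exI[of _ "\<lambda>I. series_eval (origin_solution (delta I))"] exI[of _ "\<lambda>I. series_eval (reduced I)"] ballI always_eventually allI)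
qed

end
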